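(* Let $n\ge2$ and $1\le k\le m$. The normalized $n$-point scaling limit zero correlation functions satisfy $$\widetilde K^\infty_{nkm}(z^1,\dots,z^n)=1+O(r^4e^{-r^2})\quad\text{as } r\to\infty,\qquad r=\min_{p\ne p'}|z^p-z^{p'}|,$$ for $z^1,\dots,z^n\in\mathbb C^m$.
   Context: The scaling limit zero correlation function is $K^\infty_{nkm}(z^1,\dots,z^n)=\lim_{N\to\infty}N^{-nk}K^N_{nk}(z^1/\sqrt N,\dots,z^n/\sqrt N)$ for distinct points $z^1,\dots,z^n\in\mathbb C^m$. Here $K^N_{nk}$ is the density (with respect to product Riemannian volume on $n$-tuples of distinct points) of the expected $n$-fold product of the Riemannian volume measure on the common zero set of $k$ independent Gaussian random sections of $L^N$, where $(L,h)\to M$ is a positive Hermitian line bundle over a compact $m$-dimensional complex manifold with Kähler form $\omega=\frac i2\Theta_h$, $\Theta_h=-\partial\bar\partial\log\|e_L\|_h^2$. The Gaussian measure on $H^0(M,L^N)$ is the standard one for the inner product $\int_M h^N(s_1,s_2)\,\omega^m/m!$, and the coordinates are centered at a point $z^0$ with $\omega(z^0)=\frac i2\sum dz_q\wedge d\bar z_q$. The limit does not depend on $M,L,h,z^0$. Explicitly, $$K^\infty_{nkm}(z^1,\dots,z^n)=\frac1{\pi^{kn}\det A}\Big\langle\prod_{p=1}^n\det(a^pa^{p*})\Big\rangle_\Lambda,\qquad \Lambda=C-B^*A^{-1}B,$$ where $a^p=(a^p_{jq})$ are complex $k\times m$ matrices. $\langle\cdot\rangle_\Lambda$ is expectation for the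 centered complex Gaussian vector $a=(a^p_{jq})$ with $\mathbf E(a^p_{jq}a^{p'}_{j'q'})=0$ and $\mathbf E(a^p_{jq}\overline{a^{p'}_{j'q'}})=\Lambda^{jpq}_{j'p'q'}$. The matrices $A,B,C$ have entries $$A^{jp}_{j'p'}=\delta_{jj'}e^{z^p\cdot\bar z^{p'}},\quad B^{jp}_{j'p'q'}=\delta_{jj'}z^p_{q'}e^{z^p\cdot\bar z^{p'}},\quad C^{jpq}_{j'p'q'}=\delta_{jj'}(\delta_{qq'}+\bar z^{p'}_qz^p_{q'})e^{z^p\cdot\bar z^{p'}}$$ (unprimed indices for rows, primed for columns; $1\le j,j'\le k$, $1\le p,p'\le n$, $1\le q,q'\le m$), with $z\cdot\bar w=\sum_qz_q\bar w_q$. The normalized function is $\widetilde K^\infty_{nkm}=(K^\infty_{1km})^{-n}K^\infty_{nkm}=\left(\frac{\pi^k(m-k)!}{m!}\right)^nK^\infty_{nkm}$. The implied constant in $O(\cdot)$ depends only on $n,k,m$. *)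

theory Defs
  imports "HOL-Probability.Probability" "HOL-Library.Landau_Symbols"
begin

definition conj_transpose :: "complex ^ 'c ^ 'r \<Rightarrow> complex ^ 'r ^ 'c" where
  "conj_transpose X = (\<chi> i j. cnj (X $ j $ i))"

text \<open>A vector is Gaussian if every real linear functional of it (written with the real inner
  product of \<^typ>\<open>complex ^ 'i\<close>) is normal. The variance may be zero, in which case the
  distribution is the point mass at the origin.\<close>

definition centered_complex_gaussian :: "complex ^ 'i ^ 'i \<Rightarrow> (complex ^ 'i::finite) measure \<Rightarrow> bool" where
  "centered_complex_gaussian \<Lambda> \<mu> \<longleftrightarrow>
     prob_space \<mu> \<and> sets \<mu> = sets borel \<and>
     (\<forall>u. \<exists>\<sigma>\<ge>0. distr \<mu> borel (\<lambda>a. a \<bullet> u) =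
        (if \<sigma> = 0 then return borel 0 else density lborel (normal_density 0 \<sigma>))) \<and>
     (\<forall>i i'. (LINT a|\<mu>. a $ i * a $ i') = 0) \<and>
     (\<forall>i i'. (LINT a|\<mu>. a $ i * cnj (a $ i')) = \<Lambda> $ i $ i')"

text \<open>A centered complex Gaussian measure is determined by its covariance \<open>\<Lambda>\<close>, and it exists whenever
  \<open>\<Lambda>\<close> is Hermitian positive semidefinite, so the choice below does not matter.\<close>

definition gaussian_expectation :: "complex ^ 'i ^ 'i \<Rightarrow> (complex ^ 'i::finite \<Rightarrow> complex) \<Rightarrow> complex" where
  "gaussian_expectation \<Lambda> F = (LINT a|(SOME \<mu>. centered_complex_gaussian \<Lambda> \<mu>). F a)"

definition herm_dot :: "complex ^ 'm::finite \<Rightarrow> complex ^ 'm \<Rightarrow> complex" where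
  "herm_dot z w = (\<Sum>q\<in>UNIV. z $ q * cnj (w $ q))"

text \<open>The numbers \<open>n\<close>, \<open>k\<close>, \<open>m\<close> are the cardinalities of the types \<open>'n\<close>, \<open>'k\<close>, \<open>'m\<close>. Index triples are
  ordered as \<open>(j, p, q)\<close> with \<open>j :: 'k\<close>, \<open>p :: 'n\<close>, \<open>q :: 'm\<close>.\<close>

definition mat_A :: "('n::finite \<Rightarrow> complex ^ 'm::finite) \<Rightarrow> complex ^ ('k::finite \<times> 'n) ^ ('k \<times> 'n)" where
  "mat_A z = (\<chi> jp jp'. case (jp, jp') of ((j, p), (j', p')) \<Rightarrow>
     of_bool (j = j') * exp (herm_dot (z p) (z p')))"

definition mat_B :: "('n::finite \<Rightarrow> complex ^ 'm::finite) \<Rightarrow> complex ^ ('k::finite \<times> 'n \<times> 'm) ^ ('k \<times> 'n)" where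
  "mat_B z = (\<chi> jp jpq'. case (jp, jpq') of ((j, p), (j', p', q')) \<Rightarrow>
     of_bool (j = j') * z p $ q' * exp (herm_dot (z p) (z p')))"

definition mat_C ::
  "('n::finite \<Rightarrow> complex ^ 'm::finite) \<Rightarrow> complex ^ ('k::finite \<times> 'n \<times> 'm) ^ ('k \<times> 'n \<times> 'm)" where
  "mat_C z = (\<chi> jpq jpq'. case (jpq, jpq') of ((j, p, q), (j', p', q')) \<Rightarrow>
     of_bool (j = j') * (of_bool (q = q') + cnj (z p' $ q) * z p $ q') * exp (herm_dot (z p) (z p')))"

definition mat_Lambda ::
  "('n::finite \<Rightarrow> complex ^ 'm::finite) \<Rightarrow> complex ^ ('k::finite \<times> 'n \<times> 'm) ^ ('k \<times> 'n \<times> 'm)" where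
  "mat_Lambda z = mat_C z - conj_transpose (mat_B z) ** matrix_inv (mat_A z) ** mat_B z"

definition block :: "complex ^ ('k::finite \<times> 'n::finite \<times> 'm::finite) \<Rightarrow> 'n \<Rightarrow> complex ^ 'm ^ 'k" where
  "block a p = (\<chi> j q. a $ (j, p, q))"

text \<open>The scaling limit zero correlation function, given by its explicit Gaussian formula. The
  argument of type \<open>'k itself\<close> supplies the codimension \<open>k\<close>.\<close>

definition limit_correlation ::
  "'k::finite itself \<Rightarrow> ('n::finite \<Rightarrow> complex ^ 'm::finite) \<Rightarrow> complex" where
  "limit_correlation _ z =
     1 / (of_real pi ^ (CARD('k) * CARD('n)) * det (mat_A z :: complex ^ ('k \<times> 'n) ^ ('k \<times> 'n))) *
     gaussian_expectation (mat_Lambda z :: complex ^ ('k \<times> 'n \<times> 'm) ^ ('k \<times> 'n \<times> 'm))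
       (\<lambda>a. \<Prod>p\<in>UNIV. det (block a p ** conj_transpose (block a p)))"

text \<open>The one-point function does not depend on the point, so it is evaluated at the origin. Its value
  is \<open>m! / (\<pi>^k (m - k)!)\<close>.\<close>

definition normalized_limit_correlation ::
  "'k::finite itself \<Rightarrow> ('n::finite \<Rightarrow> complex ^ 'm::finite) \<Rightarrow> complex" where
  "normalized_limit_correlation k z =
     inverse (limit_correlation k (\<lambda>_::unit. 0 :: complex ^ 'm)) ^ CARD('n) * limit_correlation k z"

definition min_separation :: "('n::finite \<Rightarrow> complex ^ 'm::finite) \<Rightarrow> real" where
  "min_separation z = Min {norm (z p - z p') | p p'. p \<noteq> p'}"

end

theory Submission
  imports Defs "HOL-Computational_Algebra.Polynomial" "HOL-Real_Asymp.Real_Asymp"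
begin

text \<open>Rescaling the values and derivatives at \<open>z p\<close> by \<open>exp (- |z p|\<^sup>2 / 2)\<close> and recentring the
  derivatives turns the covariance data into matrices whose blocks for \<open>p \<noteq> p'\<close> are
  \<open>O(r\<^sup>2 exp (- r\<^sup>2 / 2))\<close>, while \<open>A\<close> has identity diagonal blocks and those of \<open>\<Lambda>\<close> differ from the
  identity by the square of this quantity; the rescaling factors of \<open>det A\<close> and of the Gaussian
  expectation cancel. For large \<open>r\<close> the rescaled \<open>\<Lambda>\<close> is diagonally dominant, so the Gaussian vector
  exists. By Wick's formula the expectation is a sum over permutations of products of
  entries of \<open>\<Lambda>\<close>, and \<open>det A\<close> is such a sum as well. A permutation cannot leave a block only once, so
  off-diagonal blocks always enter at least quadratically, which gives the error
  \<open>r\<^sup>4 exp (- r\<^sup>2)\<close>.\<close>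

section \<open>Moments of complex Gaussian vectors\<close>

text \<open>\<open>gaussian_expectation\<close> picks its measure by Hilbert choice, so each
  evaluation rests on existence; Wick's formula then expresses the expectation through \<Lambda>
  alone, whichever measure was chosen. The definition gives only normal laws of real functionals and
  second moments, so complex mixed moments have to be derived from one-dimensional ones. The entries
  of \<open>mat_B\<close> and \<open>mat_C\<close> contain the points themselves, which are
  unbounded when only mutual distances are controlled. Recentring means passing to covariant
  derivatives: the derivative at a point minus the multiple of the value there that makes the two
  uncorrelated. Only differences of points remain, and the cross-covariance of values and
  derivatives vanishes within each point. Hence the Schur correction is a product of two small
  factors, which is what makes the diagonal blocks of \<Lambda> quadratically close to the identity.
  The factor r^2 in the off-diagonal size stems from the two coordinate differences in the
  covariance of derivatives at distinct points; squaring gives r^4.\<close>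

lemma ryser:
  fixes M :: "'s::finite \<Rightarrow> 's \<Rightarrow> 'a::comm_ring_1"
  shows "(\<Sum>T\<in>UNIV. (-1) ^ card (-T) * (\<Prod>s\<in>UNIV. \<Sum>t\<in>T. M s t)) = (\<Sum>\<pi> | bij \<pi>. \<Prod>s\<in>UNIV. M s (\<pi> s))"
proof -
  \<comment> \<open>Inclusion-exclusion: expanding the product of
    \<open>1 - of_bool (t \<notin> range f)\<close> gives the alternating sum over complements of T.
    The product itself indicates surjectivity, which on a finite type is bijectivity.\<close>
  have incl: "(\<Sum>T\<in>UNIV. (-1) ^ card (-T) * of_bool (range f \<subseteq> T)) = (of_bool (bij f) :: 'a)" for f :: "'s \<Rightarrow> 's"
  proof -
    have "(\<Prod>t\<in>UNIV. 1 - of_bool (t \<notin> range f) :: 'a)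
       = (\<Sum>X\<in>Pow UNIV. (-1) ^ card X * (\<Prod>t\<in>X. of_bool (t \<notin> range f)) * (\<Prod>t\<in>UNIV - X. 1))"
      by (rule prod_diff_conv_sum) simp
    also have "\<dots> = (\<Sum>X\<in>UNIV. (-1) ^ card X * of_bool (X \<inter> range f = {}))"
    proof (rule sum.cong)
      fix X :: "'s set"
      show "(-1) ^ card X * (\<Prod>t\<in>X. of_bool (t \<notin> range f)) * (\<Prod>t\<in>UNIV - X. 1)
        = ((-1) ^ card X * of_bool (X \<inter> range f = {}) :: 'a)"
      proof (cases "X \<inter> range f = {}")
        case True
        then have "(\<Prod>t\<in>X. of_bool (t \<notin> range f)) = (1 :: 'a)" by (intro prod.neutral) auto
        with True show ?thesis by simp
      next
        case False
        then have "(\<Prod>t\<in>X. of_bool (t \<notin> range f)) = (0 :: 'a)" by (intro prod_zero) auto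
        with False show ?thesis by simp
      qed
    qed simp
    also have "\<dots> = (\<Sum>T\<in>UNIV. (-1) ^ card (-T) * of_bool (range f \<subseteq> T))"
      by (rule sum.reindex_bij_witness[of _ uminus uminus]) (auto intro!: arg_cong2[where f="(*)"])
    finally have "(\<Sum>T\<in>UNIV. (-1) ^ card (-T) * of_bool (range f \<subseteq> T)) = (\<Prod>t\<in>UNIV. 1 - of_bool (t \<notin> range f) :: 'a)" ..
    also have "\<dots> = of_bool (surj f)"
      by (cases "surj f") (auto intro!: prod_zero)
    also have "surj f \<longleftrightarrow> bij f"
      by (simp add: bij_def finite_UNIV_surj_inj[OF finite] cong: conj_cong) (metis finite finite_UNIV_surj_inj)
    finally show ?thesis .
  qed
  have "(\<Prod>s\<in>UNIV. \<Sum>t\<in>T. M s t) = (\<Sum>f\<in>UNIV. of_bool (range f \<subseteq> T) * (\<Prod>s\<in>UNIV. M s (f s)))" for T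
  proof -
    have "(\<Prod>s\<in>UNIV. \<Sum>t\<in>T. M s t) = (\<Sum>f\<in>PiE UNIV (\<lambda>_. T). \<Prod>s\<in>UNIV. M s (f s))"
      by (rule prod_sum_PiE) auto
    also have "\<dots> = (\<Sum>f\<in>UNIV. if f \<in> PiE UNIV (\<lambda>_. T) then \<Prod>s\<in>UNIV. M s (f s) else 0)"
      by (simp add: sum.If_cases)
    also have "\<dots> = (\<Sum>f\<in>UNIV. of_bool (range f \<subseteq> T) * (\<Prod>s\<in>UNIV. M s (f s)))"
      by (rule sum.cong) (auto simp: PiE_def Pi_def)
    finally show ?thesis .
  qed
  then have "(\<Sum>T\<in>UNIV. (-1) ^ card (-T) * (\<Prod>s\<in>UNIV. \<Sum>t\<in>T. M s t))
    = (\<Sum>T\<in>UNIV. \<Sum>f\<in>UNIV. (-1) ^ card (-T) * of_bool (range f \<subseteq> T) * (\<Prod>s\<in>UNIV. M s (f s)))"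
    by (simp only: sum_distrib_left mult.assoc)
  also have "\<dots> = (\<Sum>f\<in>UNIV. of_bool (bij f) * (\<Prod>s\<in>UNIV. M s (f s)))"
    by (subst sum.swap) (simp add: incl flip: sum_distrib_right)
  also have "\<dots> = (\<Sum>\<pi> | bij \<pi>. \<Prod>s\<in>UNIV. M s (\<pi> s))"
    by (rule sum.mono_neutral_cong_right) auto
  finally show ?thesis .
qed

lemma card_bij_UNIV: "card {\<pi>::'s::finite \<Rightarrow> 's. bij \<pi>} = fact CARD('s)"
proof -
  have "{\<pi>::'s \<Rightarrow> 's. bij \<pi>} = {\<pi>. \<pi> permutes UNIV}"
    by (auto simp: permutes_def bij_iff)
  then show ?thesis by (simp add: card_permutations)
qed

text \<open>With all rows equal in \<open>ryser\<close>, every bijection contributes the same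
  product. This reduces products of linear forms to powers of partial sums, for which moment
  formulas are available.\<close>

lemma polarization:
  fixes x :: "'s::finite \<Rightarrow> 'a::{comm_ring_1,semiring_char_0}"
  shows "(\<Sum>T\<in>UNIV. (-1) ^ card (-T) * (\<Sum>t\<in>T. x t) ^ CARD('s)) = fact CARD('s) * (\<Prod>t\<in>UNIV. x t)"
proof -
  have "(\<Prod>s\<in>UNIV. x (\<pi> s)) = (\<Prod>t\<in>UNIV. x t)" if "bij \<pi>" for \<pi> :: "'s \<Rightarrow> 's"
    by (rule prod.reindex_bij_betw[OF that])
  then show ?thesis
    using ryser[of "\<lambda>s. x"] by (simp add: card_bij_UNIV)
qed

text \<open>Comparison of every summand with the largest one; the crude constant suffices because it
  only serves integrability.\<close>

lemma sum_power_le_card_power: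
  fixes x :: "'b \<Rightarrow> real"
  assumes "finite B" "B \<noteq> {}" "\<And>b. b \<in> B \<Longrightarrow> 0 \<le> x b"
  shows "(\<Sum>b\<in>B. x b) ^ n \<le> card B ^ n * (\<Sum>b\<in>B. x b ^ n)"
proof -
  obtain m where m: "m \<in> B" "\<And>b. b \<in> B \<Longrightarrow> x b \<le> x m"
  proof -
    have "Max (x ` B) \<in> x ` B" using assms by (intro Max_in) auto
    then obtain m where "m \<in> B" "x m = Max (x ` B)" by auto
    with that[of m] show thesis using assms by simp
  qed
  have "(\<Sum>b\<in>B. x b) \<le> card B * x m"
    using sum_bounded_above[of B x "x m"] m by simp
  then have "(\<Sum>b\<in>B. x b) ^ n \<le> (card B * x m) ^ n"
    using assms by (intro power_mono sum_nonneg) auto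
  also have "\<dots> = card B ^ n * x m ^ n" by (simp add: power_mult_distrib)
  also have "x m ^ n \<le> (\<Sum>b\<in>B. x b ^ n)"
    using m assms by (intro member_le_sum) auto
  finally show ?thesis by (simp add: mult_left_mono)
qed

section \<open>From one-dimensional normal moments to Wick's formula\<close>

locale complex_gaussian =
  fixes \<Lambda> :: "complex ^ 'i ^ 'i" and \<mu> :: "(complex ^ 'i::finite) measure"
  assumes gaussian: "centered_complex_gaussian \<Lambda> \<mu>"
begin

sublocale prob_space \<mu>
  using gaussian by (simp add: centered_complex_gaussian_def)

lemma sets_eq[measurable_cong, simp]: "sets \<mu> = sets borel"
  using gaussian by (simp add: centered_complex_gaussian_def)

text \<open>Expressing even moments by the second moment eliminates \<sigma>, covers the point mass
  as well, and leaves an identity polynomial in the functional, which can be continued to complex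
  functionals.\<close>

lemma functional_moment:
  "integrable \<mu> (\<lambda>a. (a \<bullet> u) ^ n)"
  "(LINT a|\<mu>. (a \<bullet> u) ^ (2 * d)) = fact (2 * d) / (2 ^ d * fact d) * (LINT a|\<mu>. (a \<bullet> u)\<^sup>2) ^ d"
proof -
  obtain \<sigma> where \<sigma>: "\<sigma> \<ge> 0" and distr: "distr \<mu> borel (\<lambda>a. a \<bullet> u) =
      (if \<sigma> = 0 then return borel 0 else density lborel (normal_density 0 \<sigma>))"
    using gaussian unfolding centered_complex_gaussian_def by meson
  have meas: "(\<lambda>a. a \<bullet> u) \<in> borel_measurable \<mu>" by measurable
  have E: "(LINT a|\<mu>. (a \<bullet> u) ^ j) = (LINT x|distr \<mu> borel (\<lambda>a. a \<bullet> u). x ^ j)" for j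
    by (subst integral_distr[OF meas]) auto
  have I: "integrable \<mu> (\<lambda>a. (a \<bullet> u) ^ j) \<longleftrightarrow> integrable (distr \<mu> borel (\<lambda>a. a \<bullet> u)) (\<lambda>x. x ^ j)" for j
    by (subst integrable_distr_eq[OF meas]) auto
  have "(\<forall>n. integrable \<mu> (\<lambda>a. (a \<bullet> u) ^ n)) \<and>
    (\<forall>d. (LINT a|\<mu>. (a \<bullet> u) ^ (2 * d)) = fact (2 * d) / (2 ^ d * fact d) * (\<sigma>\<^sup>2) ^ d)"
  proof (cases "\<sigma> = 0")
    case True
    have "integrable (return borel (0::real)) (\<lambda>x. x ^ j)" for j
    proof (rule finite_measure.integrable_const_bound)
      show "finite_measure (return borel (0::real))"
        by (intro prob_space.finite_measure prob_space_return) simp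
      show "AE x in return borel (0::real). norm (x ^ j) \<le> 1"
        by (subst AE_return) (auto simp: power_0_left)
    qed simp
    with True show ?thesis
      unfolding E I distr by (auto simp: integral_return power_0_left)
  next
    case False
    with \<sigma> have pos: "\<sigma> > 0" by simp
    have "integrable (density lborel (normal_density 0 \<sigma>)) (\<lambda>x. x ^ j)" for j
      using integrable_normal_moment[OF pos, of 0 j] by (subst integrable_density) auto
    moreover have "(LINT x|density lborel (normal_density 0 \<sigma>). x ^ (2 * d)) = fact (2 * d) / (2 ^ d * fact d) * (\<sigma>\<^sup>2) ^ d" for d
      using integral_normal_moment_even[OF pos, of 0 d] pos
      by (subst integral_density) (auto simp: field_simps)
    ultimately show ?thesis
      using False unfolding E I distr by auto
  qed
  then have i: "\<And>n. integrable \<mu> (\<lambda>a. (a \<bullet> u) ^ n)" and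
    m: "\<And>d. (LINT a|\<mu>. (a \<bullet> u) ^ (2 * d)) = fact (2 * d) / (2 ^ d * fact d) * (\<sigma>\<^sup>2) ^ d" by auto
  show "integrable \<mu> (\<lambda>a. (a \<bullet> u) ^ n)" by (rule i)
  show "(LINT a|\<mu>. (a \<bullet> u) ^ (2 * d)) = fact (2 * d) / (2 ^ d * fact d) * (LINT a|\<mu>. (a \<bullet> u)\<^sup>2) ^ d"
    using m[of 1] m[of d] by simp
qed

lemma integrable_norm_power: "integrable \<mu> (\<lambda>a. norm a ^ n)"
proof (rule Bochner_Integration.integrable_bound)
  let ?B = "Basis :: (complex ^ 'i) set"
  show "integrable \<mu> (\<lambda>a. card ?B ^ n * (\<Sum>b\<in>?B. \<bar>a \<bullet> b\<bar> ^ n))"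
    using functional_moment(1) by (auto simp flip: power_abs intro!: Bochner_Integration.integrable_sum integrable_abs)
  show "AE a in \<mu>. norm (norm a ^ n) \<le> norm (card ?B ^ n * (\<Sum>b\<in>?B. \<bar>a \<bullet> b\<bar> ^ n))"
  proof (rule AE_I2)
    fix a :: "complex ^ 'i"
    have "norm a ^ n \<le> (\<Sum>b\<in>?B. \<bar>a \<bullet> b\<bar>) ^ n"
      by (intro power_mono norm_le_l1) auto
    also have "\<dots> \<le> card ?B ^ n * (\<Sum>b\<in>?B. \<bar>a \<bullet> b\<bar> ^ n)"
      by (rule sum_power_le_card_power) auto
    finally show "norm (norm a ^ n) \<le> norm (card ?B ^ n * (\<Sum>b\<in>?B. \<bar>a \<bullet> b\<bar> ^ n))" by simp
  qed
qed measurable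

lemma integrable_polynomial_growth:
  fixes F :: "complex ^ 'i \<Rightarrow> 'b::{banach,second_countable_topology}"
  assumes "F \<in> borel_measurable borel" "\<And>a. norm (F a) \<le> C * norm a ^ n"
  shows "integrable \<mu> F"
proof (rule Bochner_Integration.integrable_bound)
  show "integrable \<mu> (\<lambda>a. C * norm a ^ n)" using integrable_norm_power by simp
  show "F \<in> borel_measurable \<mu>" using assms(1) by (simp cong: measurable_cong_sets)
  show "AE a in \<mu>. norm (F a) \<le> norm (C * norm a ^ n)"
    using assms(2) by (intro AE_I2) (metis abs_ge_self order_trans real_norm_def)
qed

lemma integrable_mult_linear_powers:
  fixes f g :: "complex ^ 'i \<Rightarrow> complex"
  assumes "linear f" "linear g"
  shows "integrable \<mu> (\<lambda>a. f a ^ i * g a ^ j)"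
proof -
  obtain C D where C: "\<And>a. norm (f a) \<le> norm a * C" "C > 0" and D: "\<And>a. norm (g a) \<le> norm a * D" "D > 0"
    using bounded_linear.pos_bounded assms linear_conv_bounded_linear by metis
  have [measurable]: "f \<in> borel_measurable borel" "g \<in> borel_measurable borel"
    using assms by (auto intro!: borel_measurable_continuous_onI linear_continuous_on simp: linear_conv_bounded_linear)
  show ?thesis
  proof (rule integrable_polynomial_growth)
    fix a
    have "norm (f a ^ i * g a ^ j) \<le> (norm a * C) ^ i * (norm a * D) ^ j"
      using C D by (simp add: norm_mult norm_power) (intro mult_mono power_mono; simp)
    then show "norm (f a ^ i * g a ^ j) \<le> (C ^ i * D ^ j) * norm a ^ (i + j)"
      by (simp add: power_mult_distrib power_add mult_ac)
  qed measurable
qed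

text \<open>Moments along the line f + t g are polynomials in the complex parameter t. This permits
  both continuation from real t to t = \<open>\<i>\<close> and comparison of coefficients.\<close>

lemma expectation_binomial:
  fixes f g :: "complex ^ 'i \<Rightarrow> complex"
  assumes "linear f" "linear g"
  shows "(LINT a|\<mu>. (f a + t * g a) ^ n) = (\<Sum>j\<le>n. of_nat (n choose j) * (LINT a|\<mu>. f a ^ (n - j) * g a ^ j) * t ^ j)"
proof -
  have "(f a + t * g a) ^ n = (\<Sum>j\<le>n. of_nat (n choose j) * t ^ j * (f a ^ (n - j) * g a ^ j))" for a
    using binomial_ring[of "t * g a" "f a" n] by (simp add: power_mult_distrib mult_ac add.commute)
  then show ?thesis
    using integrable_mult_linear_powers[OF assms]
    by (simp add: Bochner_Integration.integral_sum del: mult.assoc) (simp add: mult_ac)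
qed

lemma real_functional:
  fixes U :: "complex ^ 'i \<Rightarrow> real"
  assumes "linear U"
  obtains u where "U = (\<lambda>a. a \<bullet> u)"
proof
  show "U = (\<lambda>a. a \<bullet> (\<Sum>b\<in>Basis. U b *\<^sub>R b))"
  proof
    fix a
    have "U a = U (\<Sum>b\<in>Basis. (a \<bullet> b) *\<^sub>R b)" by (simp add: euclidean_representation)
    also have "\<dots> = (\<Sum>b\<in>Basis. (a \<bullet> b) * U b)" using assms by (simp add: linear_sum linear_scale)
    finally show "U a = a \<bullet> (\<Sum>b\<in>Basis. U b *\<^sub>R b)" by (simp add: inner_sum_right mult.commute)
  qed
qed

text \<open>With f = U + \<open>\<i>\<close> V split into real and imaginary part, the identity for
  U + t V is polynomial in t and holds for real t, where U + t V is a real functional. The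
  difference P of the two sides thus has infinitely many roots and vanishes at t =
  \<open>\<i>\<close> too.\<close>

lemma linear_moment_even:
  fixes f :: "complex ^ 'i \<Rightarrow> complex"
  assumes "linear f"
  shows "(LINT a|\<mu>. f a ^ (2 * d)) = fact (2 * d) / (2 ^ d * fact d) * (LINT a|\<mu>. (f a)\<^sup>2) ^ d"
proof -
  let ?c = "fact (2 * d) / (2 ^ d * fact d) :: complex"
  define U V :: "complex ^ 'i \<Rightarrow> complex" where "U = (\<lambda>a. of_real (Re (f a)))" and "V = (\<lambda>a. of_real (Im (f a)))"
  have lin: "linear U" "linear V"
    using assms by (auto simp: U_def V_def linear_iff scaleR_conv_of_real)
  define P where "P = (\<Sum>j\<le>2 * d. monom (of_nat (2 * d choose j) * (LINT a|\<mu>. U a ^ (2 * d - j) * V a ^ j)) j)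
     - smult ?c ((\<Sum>j\<le>2. monom (of_nat (2 choose j) * (LINT a|\<mu>. U a ^ (2 - j) * V a ^ j)) j) ^ d)"
  have P: "poly P t = (LINT a|\<mu>. (U a + t * V a) ^ (2 * d)) - ?c * (LINT a|\<mu>. (U a + t * V a)\<^sup>2) ^ d" for t
    unfolding expectation_binomial[OF lin] by (simp add: P_def poly_sum poly_monom)
  have "poly P (of_real t) = 0" for t
  proof -
    have "linear (\<lambda>a. Re (f a) + t * Im (f a))" using assms by (auto simp: linear_iff algebra_simps)
    then obtain u where u: "(\<lambda>a. Re (f a) + t * Im (f a)) = (\<lambda>a. a \<bullet> u)" by (rule real_functional)
    have eq: "U a + of_real t * V a = of_real (a \<bullet> u)" for a
      using fun_cong[OF u, of a] by (simp add: U_def V_def flip: of_real_mult of_real_add)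
    have "(LINT a|\<mu>. (U a + of_real t * V a) ^ n) = of_real (LINT a|\<mu>. (a \<bullet> u) ^ n)" for n
      unfolding eq by (simp flip: of_real_power)
    then show ?thesis unfolding P by (simp add: functional_moment(2))
  qed
  then have "range of_real \<subseteq> {x. poly P x = 0}" by auto
  moreover have "infinite (range (of_real :: real \<Rightarrow> complex))"
    using finite_imageD[of of_real "UNIV :: real set"] infinite_UNIV_char_0 by (auto simp: inj_def)
  ultimately have "P = 0" using poly_roots_finite finite_subset by blast
  then have "poly P \<i> = 0" by simp
  moreover have "U a + \<i> * V a = f a" for a by (simp add: U_def V_def flip: complex_eq)
  ultimately show ?thesis unfolding P by simp
qed

text \<open>Since the squares of f and g have mean zero, the second moment of f + t g is 2 t E(f g).
  The moment of order 2d is therefore a multiple of t^d, and the coefficient of t^d gives the claim.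
  Linearity is over the reals, so g may be built from conjugated coordinates.\<close>

lemma mixed_moment:
  fixes f g :: "complex ^ 'i \<Rightarrow> complex"
  assumes lin: "linear f" "linear g" and zero: "(LINT a|\<mu>. (f a)\<^sup>2) = 0" "(LINT a|\<mu>. (g a)\<^sup>2) = 0"
  shows "(LINT a|\<mu>. f a ^ d * g a ^ d) = fact d * (LINT a|\<mu>. f a * g a) ^ d"
proof -
  let ?c = "fact (2 * d) / (2 ^ d * fact d) :: complex" and ?M = "LINT a|\<mu>. f a * g a"
  let ?e = "\<lambda>j. of_nat (2 * d choose j) * (LINT a|\<mu>. f a ^ (2 * d - j) * g a ^ j)"
  have "(\<Sum>j\<le>2 * d. ?e j * t ^ j) = (\<Sum>j\<le>2 * d. (if j = d then ?c * (2 * ?M) ^ d else 0) * t ^ j)" for t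
  proof -
    have "linear (\<lambda>a. f a + t * g a)" using lin by (auto simp: linear_iff algebra_simps)
    then have "(LINT a|\<mu>. (f a + t * g a) ^ (2 * d)) = ?c * (LINT a|\<mu>. (f a + t * g a)\<^sup>2) ^ d"
      by (rule linear_moment_even)
    also have "(LINT a|\<mu>. (f a + t * g a)\<^sup>2) = 2 * ?M * t"
      unfolding expectation_binomial[OF lin] using zero by (simp add: numeral_2_eq_2)
    finally show ?thesis
      unfolding expectation_binomial[OF lin] by (simp add: power_mult_distrib if_distrib[of "\<lambda>x. x * _"] cong: if_cong)
  qed
  then have "\<forall>j\<le>2*d. ?e j = (if j = d then ?c * (2 * ?M) ^ d else 0)"
    using polyfun_eq_coeffs[of ?e "2 * d" "\<lambda>j. if j = d then ?c * (2 * ?M) ^ d else 0"] by blast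
  then have "d \<le> 2 * d \<longrightarrow> ?e d = (if d = d then ?c * (2 * ?M) ^ d else 0)" ..
  then have "?e d = ?c * (2 * ?M) ^ d" by simp
  moreover have "(of_nat (2 * d choose d) :: complex) = fact (2 * d) / (fact d * fact d)"
    by (subst binomial_fact) auto
  moreover have two_d: "2 * d - d = d" by simp
  ultimately have "fact (2 * d) / (fact d * fact d) * (LINT a|\<mu>. f a ^ d * g a ^ d)
      = fact (2 * d) / (2 ^ d * fact d) * (2 ^ d * ?M ^ d)"
    by (simp only: power_mult_distrib two_d)
  then have "(fact (2 * d) / (fact d * fact d) * (LINT a|\<mu>. f a ^ d * g a ^ d)) * (fact d * fact d)
      = (fact (2 * d) / (2 ^ d * fact d) * (2 ^ d * ?M ^ d)) * (fact d * fact d)"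
    by (rule arg_cong)
  then have "fact (2 * d) * (LINT a|\<mu>. f a ^ d * g a ^ d) = fact (2 * d) * (fact d * ?M ^ d)"
    by simp
  then show ?thesis by (rule mult_left_cancel[THEN iffD1, OF fact_nonzero])
qed

lemma integrable_component_mult: "integrable \<mu> (\<lambda>a. a $ i * a $ j)" "integrable \<mu> (\<lambda>a. a $ i * cnj (a $ j))"
  using integrable_mult_linear_powers[of "\<lambda>a. a $ i" "\<lambda>a. a $ j" 1 1] integrable_mult_linear_powers[of "\<lambda>a. a $ i" "\<lambda>a. cnj (a $ j)" 1 1]
  by (simp_all add: linear_iff)

lemma pseudo_covariance: "(LINT a|\<mu>. a $ i * a $ j) = 0"
  and covariance: "(LINT a|\<mu>. a $ i * cnj (a $ j)) = \<Lambda> $ i $ j"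
  using gaussian by (auto simp: centered_complex_gaussian_def)

text \<open>The plain and the conjugated factors are polarized separately, into powers of the
  partial sums Z T and W T'. Vanishing pseudo-covariance makes \<open>mixed_moment\<close>
  applicable to each pair.\<close>

theorem wick:
  fixes f g :: "'s::finite \<Rightarrow> 'i"
  shows "(LINT a|\<mu>. (\<Prod>s\<in>UNIV. a $ f s * cnj (a $ g s))) = (\<Sum>\<pi> | bij \<pi>. \<Prod>s\<in>UNIV. \<Lambda> $ f s $ g (\<pi> s))"
    and integrable_wick: "integrable \<mu> (\<lambda>a. \<Prod>s\<in>UNIV. a $ f s * cnj (a $ g s))"
proof -
  let ?d = "CARD('s)"
  define Z where "Z T a = (\<Sum>s\<in>T. a $ f s)" for T and a :: "complex ^ 'i"
  define W where "W T a = (\<Sum>s\<in>T. cnj (a $ g s))" for T and a :: "complex ^ 'i"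
  define e :: "'s set \<Rightarrow> complex" where "e T = (-1) ^ card (-T)" for T
  have lin: "linear (Z T)" "linear (W T)" for T
    unfolding Z_def W_def by (auto simp: linear_iff sum.distrib scaleR_sum_right)
  have ZZ: "(LINT a|\<mu>. (Z T a)\<^sup>2) = 0" for T
    using integrable_component_mult by (simp add: Z_def power2_eq_square sum_product pseudo_covariance)
  have WW: "(LINT a|\<mu>. (W T a)\<^sup>2) = 0" for T
  proof -
    have "(W T a)\<^sup>2 = cnj (\<Sum>s\<in>T. \<Sum>t\<in>T. a $ g s * a $ g t)" for a
      by (simp add: W_def power2_eq_square sum_product)
    then have "(LINT a|\<mu>. (W T a)\<^sup>2) = cnj (LINT a|\<mu>. (\<Sum>s\<in>T. \<Sum>t\<in>T. a $ g s * a $ g t))"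
      by (simp only: Bochner_Integration.integral_cnj)
    then show ?thesis
      using integrable_component_mult by (simp add: pseudo_covariance)
  qed
  have ZW: "(LINT a|\<mu>. Z T a * W T' a) = (\<Sum>s\<in>T. \<Sum>t\<in>T'. \<Lambda> $ f s $ g t)" for T T'
    using integrable_component_mult by (simp add: Z_def W_def sum_product covariance)
  have *: "fact ?d * (\<Prod>s\<in>UNIV. a $ f s) = (\<Sum>T\<in>UNIV. e T * Z T a ^ ?d)"
    and **: "fact ?d * (\<Prod>s\<in>UNIV. cnj (a $ g s)) = (\<Sum>T\<in>UNIV. e T * W T a ^ ?d)" for a
    unfolding Z_def W_def e_def by (simp_all add: polarization)
  have expand: "(fact ?d * fact ?d) * (\<Prod>s\<in>UNIV. a $ f s * cnj (a $ g s)) =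
      (\<Sum>T'\<in>UNIV. \<Sum>T\<in>UNIV. e T' * e T * (Z T a ^ ?d * W T' a ^ ?d))" for a
  proof -
    have "(fact ?d * fact ?d) * (\<Prod>s\<in>UNIV. a $ f s * cnj (a $ g s)) =
        (fact ?d * (\<Prod>s\<in>UNIV. cnj (a $ g s))) * (fact ?d * (\<Prod>s\<in>UNIV. a $ f s))"
      by (simp only: prod.distrib mult_ac)
    also have "\<dots> = (\<Sum>T\<in>UNIV. e T * W T a ^ ?d) * (\<Sum>T\<in>UNIV. e T * Z T a ^ ?d)"
      by (simp only: * **)
    finally show ?thesis by (simp only: sum_product mult_ac)
  qed
  have int: "integrable \<mu> (\<lambda>a. Z T a ^ ?d * W T' a ^ ?d)" for T T'
    by (intro integrable_mult_linear_powers lin)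
  then have "integrable \<mu> (\<lambda>a. (fact ?d * fact ?d) * (\<Prod>s\<in>UNIV. a $ f s * cnj (a $ g s)))"
    unfolding expand by simp
  then have "integrable \<mu> (\<lambda>a. 1 / (fact ?d * fact ?d) * ((fact ?d * fact ?d) * (\<Prod>s\<in>UNIV. a $ f s * cnj (a $ g s))))"
    by (rule integrable_mult_right)
  then show "integrable \<mu> (\<lambda>a. \<Prod>s\<in>UNIV. a $ f s * cnj (a $ g s))"
    by simp
  have "(fact ?d * fact ?d) * (LINT a|\<mu>. (\<Prod>s\<in>UNIV. a $ f s * cnj (a $ g s))) =
      (LINT a|\<mu>. (fact ?d * fact ?d) * (\<Prod>s\<in>UNIV. a $ f s * cnj (a $ g s)))" by simp
  also have "\<dots> = (\<Sum>T'\<in>UNIV. \<Sum>T\<in>UNIV. e T' * e T * (LINT a|\<mu>. Z T a ^ ?d * W T' a ^ ?d))"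
    unfolding expand using int by simp
  also have "\<dots> = (\<Sum>T'\<in>UNIV. e T' * fact ?d * (\<Sum>T\<in>UNIV. e T * (\<Sum>s\<in>T. \<Sum>t\<in>T'. \<Lambda> $ f s $ g t) ^ ?d))"
    by (simp only: mixed_moment[OF lin ZZ WW] ZW) (simp only: sum_distrib_left mult_ac)
  \<comment> \<open>For fixed T', polarization read backwards, with the row sums over T' as
    variables, removes the sum over T. The remaining alternating sum over T' is the permanent
    expression of \<open>ryser\<close>.\<close>
  also have "\<dots> = (\<Sum>T'\<in>UNIV. e T' * fact ?d * (fact ?d * (\<Prod>s\<in>UNIV. \<Sum>t\<in>T'. \<Lambda> $ f s $ g t)))"
    unfolding e_def polarization ..
  also have "\<dots> = (fact ?d * fact ?d) * (\<Sum>T'\<in>UNIV. e T' * (\<Prod>s\<in>UNIV. \<Sum>t\<in>T'. \<Lambda> $ f s $ g t))"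
    by (simp add: sum_distrib_left mult_ac)
  finally have "(LINT a|\<mu>. (\<Prod>s\<in>UNIV. a $ f s * cnj (a $ g s))) = (\<Sum>T'\<in>UNIV. e T' * (\<Prod>s\<in>UNIV. \<Sum>t\<in>T'. \<Lambda> $ f s $ g t))"
    by simp
  also have "\<dots> = (\<Sum>\<pi> | bij \<pi>. \<Prod>s\<in>UNIV. \<Lambda> $ f s $ g (\<pi> s))"
    unfolding e_def by (rule ryser)
  finally show "(LINT a|\<mu>. (\<Prod>s\<in>UNIV. a $ f s * cnj (a $ g s))) = (\<Sum>\<pi> | bij \<pi>. \<Prod>s\<in>UNIV. \<Lambda> $ f s $ g (\<pi> s))" .
qed

end

section \<open>Existence of complex Gaussian vectors\<close>

lemma std_normal_product:
  fixes c :: "'j::finite \<Rightarrow> real"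
  defines "N \<equiv> PiM (UNIV :: 'j set) (\<lambda>_. density lborel std_normal_density)"
  defines "s \<equiv> sqrt (\<Sum>j\<in>UNIV. (c j)\<^sup>2)"
  shows "distr N borel (\<lambda>\<omega>. \<Sum>j\<in>UNIV. c j * \<omega> j) =
     (if s = 0 then return borel 0 else density lborel (normal_density 0 s))" (is ?D)
    and "has_bochner_integral N (\<lambda>\<omega>. (\<Sum>j\<in>UNIV. c j * \<omega> j)\<^sup>2) (\<Sum>j\<in>UNIV. (c j)\<^sup>2)" (is ?I)
    and "prob_space N" and "sets N = sets (PiM UNIV (\<lambda>_. borel))"
proof -
  let ?S = "density lborel std_normal_density :: real measure"
  have S: "prob_space ?S" by (rule prob_space_normal_density) simp
  have sets_S: "sets ?S = sets borel" by simp
  show sets_N: "sets N = sets (PiM UNIV (\<lambda>_. borel))"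
    unfolding N_def by (intro sets_PiM_cong) auto
  show P: "prob_space N" unfolding N_def by (intro prob_space_PiM S)
  interpret prob_space N by (rule P)
  have meas[measurable]: "(\<lambda>\<omega>. \<omega> j) \<in> borel_measurable N" for j
    unfolding measurable_cong_sets[OF sets_N refl] by measurable
  have comp: "distr N borel (\<lambda>\<omega>. \<omega> j) = ?S" for j
  proof -
    have "distr N borel (\<lambda>\<omega>. \<omega> j) = distr N ?S (\<lambda>\<omega>. \<omega> j)" by (rule distr_cong) auto
    also have "\<dots> = ?S" unfolding N_def by (rule distr_PiM_component[OF S]) auto
    finally show ?thesis .
  qed
  have normal: "distributed N lborel (\<lambda>\<omega>. \<omega> j) std_normal_density" for j
    using comp[of j] meas[of j] by (simp add: distributed_def cong: distr_cong)
  have indep: "indep_vars (\<lambda>_. borel) (\<lambda>j \<omega>. \<omega> j) UNIV"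
  proof (subst indep_vars_iff_distr_eq_PiM)
    show "distr N (PiM UNIV (\<lambda>_. borel)) (\<lambda>x. \<lambda>i\<in>UNIV. x i) = PiM UNIV (\<lambda>i. distr N borel (\<lambda>\<omega>. \<omega> i))"
      using sets_N by (simp add: comp N_def[symmetric] distr_id2 restrict_UNIV)
  qed auto
  \<comment> \<open>The theorem on sums of independent normal variables requires positive deviations
    and a nonempty index set, so vanishing coefficients are discarded and the case of no remaining
    ones is treated as a point mass.\<close>
  define J where "J = {j. c j \<noteq> 0}"
  have sumJ: "(\<Sum>j\<in>UNIV. c j * \<omega> j) = (\<Sum>j\<in>J. c j * \<omega> j)" for \<omega>
    by (rule sum.mono_neutral_right) (auto simp: J_def)
  have sumJ2: "(\<Sum>j\<in>UNIV. (c j)\<^sup>2) = (\<Sum>j\<in>J. (\<bar>c j\<bar> * 1)\<^sup>2)"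
    by (simp, rule sum.mono_neutral_right) (auto simp: J_def)
  have s0: "s = 0 \<longleftrightarrow> J = {}"
    by (auto simp: s_def J_def sum_nonneg_eq_0_iff)
  have s2: "s\<^sup>2 = (\<Sum>j\<in>UNIV. (c j)\<^sup>2)" by (simp add: s_def sum_nonneg)
  have "?D \<and> ?I"
  proof (cases "J = {}")
    case True
    then have c0: "c = (\<lambda>_. 0)" by (auto simp: J_def)
    have "distr N borel (\<lambda>\<omega>. 0) = return borel (0::real)"
      by (rule measure_eqI) (auto simp: emeasure_distr emeasure_return emeasure_space_1 indicator_def)
    with c0 s0 True show ?thesis by (simp add: has_bochner_integral_zero)
  next
    case False
    have "distributed N lborel (\<lambda>\<omega>. \<Sum>j\<in>J. c j * \<omega> j)
        (normal_density (\<Sum>j\<in>J. 0) (sqrt (\<Sum>j\<in>J. (\<bar>c j\<bar> * 1)\<^sup>2)))"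
    proof (rule sum_indep_normal)
      show "indep_vars (\<lambda>_. borel) (\<lambda>j \<omega>. c j * \<omega> j) J"
        using indep_vars_compose2[OF indep_vars_subset[OF indep], of J "\<lambda>j x. c j * x" "\<lambda>_. borel"] by simp
      show "distributed N lborel (\<lambda>\<omega>. c j * \<omega> j) (normal_density 0 (\<bar>c j\<bar> * 1))" if "j \<in> J" for j
        using normal_density_affine[OF normal, of "c j" 0] that by (simp add: J_def)
    qed (use False in \<open>auto simp: J_def\<close>)
    then have D: "distributed N lborel (\<lambda>\<omega>. \<Sum>j\<in>UNIV. c j * \<omega> j) (normal_density 0 s)"
      by (simp add: sumJ s_def sumJ2)
    have "distr N borel (\<lambda>\<omega>. \<Sum>j\<in>UNIV. c j * \<omega> j) = distr N lborel (\<lambda>\<omega>. \<Sum>j\<in>UNIV. c j * \<omega> j)"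
      by (rule distr_cong) auto
    then have D': "distr N borel (\<lambda>\<omega>. \<Sum>j\<in>UNIV. c j * \<omega> j) = density lborel (normal_density 0 s)"
      using D by (simp add: distributed_def)
    have pos: "s > 0" using False s0 sum_nonneg[of UNIV "\<lambda>j. (c j)\<^sup>2"] by (simp add: s_def less_le)
    have "has_bochner_integral (density lborel (normal_density 0 s)) (\<lambda>x. x\<^sup>2) (s\<^sup>2)"
      using normal_moment_even[OF pos, of 0 1] pos
      by (subst has_bochner_integral_density) (auto simp: fact_numeral field_simps power2_eq_square)
    then have "has_bochner_integral N (\<lambda>\<omega>. (\<Sum>j\<in>UNIV. c j * \<omega> j)\<^sup>2) (s\<^sup>2)"
      unfolding D'[symmetric] by (simp add: has_bochner_integral_iff integrable_distr_eq integral_distr)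
    with D' pos s2 show ?thesis by simp
  qed
  then show ?D ?I by auto
qed

lemma std_normal_product_covariance:
  fixes i j :: "'j::finite"
  defines "N \<equiv> PiM (UNIV :: 'j set) (\<lambda>_. density lborel std_normal_density)"
  shows "has_bochner_integral N (\<lambda>\<omega>. \<omega> i * \<omega> j) (of_bool (i = j))"
proof -
  have S: "has_bochner_integral N (\<lambda>\<omega>. (\<Sum>j\<in>UNIV. c j * \<omega> j)\<^sup>2) (\<Sum>j\<in>UNIV. (c j)\<^sup>2)" for c
    unfolding N_def by (rule std_normal_product)
  have single: "has_bochner_integral N (\<lambda>\<omega>. (\<omega> i)\<^sup>2) 1" for i
    using S[of "\<lambda>k. if k = i then 1 else 0"]
    by (simp add: if_distrib[of "\<lambda>x. x * _"] if_distrib[of "\<lambda>x. x\<^sup>2"] cong: if_cong)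
  show ?thesis
  proof (cases "i = j")
    case True
    then show ?thesis using single[of i] by (simp add: power2_eq_square)
  next
    case False
    have "(of_bool (k = i) + of_bool (k = j))\<^sup>2 = (of_bool (k = i) + of_bool (k = j) :: real)" for k
      using False by auto
    then have "has_bochner_integral N (\<lambda>\<omega>. (\<omega> i + \<omega> j)\<^sup>2) 2"
      using S[of "\<lambda>k. of_bool (k = i) + of_bool (k = j)"]
      by (simp add: distrib_right sum.distrib)
    then have "has_bochner_integral N (\<lambda>\<omega>. ((\<omega> i + \<omega> j)\<^sup>2 - (\<omega> i)\<^sup>2 - (\<omega> j)\<^sup>2) / 2) ((2 - 1 - 1) / 2)"
      by (intro has_bochner_integral_divide_zero has_bochner_integral_diff single)
    with False show ?thesis by (simp add: power2_eq_square algebra_simps)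
  qed
qed

text \<open>The measure is the law of T applied to independent standard complex Gaussians indexed by
  \<open>'x\<close>, so any factorization of \<Lambda> as T times its adjoint yields
  existence.\<close>

lemma centered_complex_gaussian_exists:
  fixes T :: "'i::finite \<Rightarrow> 'x::finite \<Rightarrow> complex"
  assumes \<Lambda>: "\<And>a b. \<Lambda> $ a $ b = (\<Sum>x\<in>UNIV. T a x * cnj (T b x))"
  shows "\<exists>\<mu>. centered_complex_gaussian \<Lambda> \<mu>"
proof -
  define N where "N = PiM (UNIV :: ('x \<times> bool) set) (\<lambda>_. density lborel std_normal_density)"
  \<comment> \<open>Each complex Gaussian is (X + \<open>\<i>\<close> Y) / sqrt 2 with independent
    real X and Y; the Boolean tag \<open>True\<close> marks the imaginary part. In the
    pseudo-covariance the two parts cancel because \<open>\<i>\<close> squares to -1, while in the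
    covariance they add up to 1.\<close>
  define v :: "'x \<times> bool \<Rightarrow> complex ^ 'i" where
    "v = (\<lambda>(x, b). \<chi> a. (if b then \<i> else 1) * T a x / of_real (sqrt 2))"
  define h where "h \<omega> = (\<Sum>j\<in>UNIV. \<omega> j *\<^sub>R v j)" for \<omega>
  define \<mu> where "\<mu> = distr N borel h"
  note std = std_normal_product[where 'j = "'x \<times> bool", folded N_def]
  interpret N: prob_space N by (rule std)
  have [measurable]: "(\<lambda>\<omega>. \<omega> j) \<in> borel_measurable N" for j
    unfolding measurable_cong_sets[OF std(4) refl] by measurable
  have meas[measurable]: "h \<in> borel_measurable N"
    unfolding h_def by measurable
  have inner: "h \<omega> \<bullet> u = (\<Sum>j\<in>UNIV. (v j \<bullet> u) * \<omega> j)" for \<omega> u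
    by (simp add: h_def inner_sum_left mult.commute)
  have gauss: "distr \<mu> borel (\<lambda>a. a \<bullet> u) = (let \<sigma> = sqrt (\<Sum>j\<in>UNIV. (v j \<bullet> u)\<^sup>2) in
      (if \<sigma> = 0 then return borel 0 else density lborel (normal_density 0 \<sigma>)))" for u
    unfolding \<mu>_def Let_def std(1)[symmetric] by (subst distr_distr) (auto simp: comp_def inner)
  have comp: "h \<omega> $ a = (\<Sum>j\<in>UNIV. of_real (\<omega> j) * v j $ a)" for \<omega> a
    by (simp only: h_def sum_component vector_scaleR_component) (simp only: scaleR_conv_of_real)
  have cov: "has_bochner_integral N (\<lambda>\<omega>. (\<Sum>j\<in>UNIV. of_real (\<omega> j) * p j) * (\<Sum>j\<in>UNIV. of_real (\<omega> j) * q j))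
      (\<Sum>j\<in>UNIV. p j * q j)" for p q :: "'x \<times> bool \<Rightarrow> complex"
  proof -
    have "has_bochner_integral N (\<lambda>\<omega>. of_real (\<omega> i * \<omega> j) :: complex) (of_real (of_bool (i = j)))" for i j
      unfolding N_def by (intro has_bochner_integral_of_real std_normal_product_covariance)
    then have "has_bochner_integral N (\<lambda>\<omega>. \<Sum>i\<in>UNIV. \<Sum>j\<in>UNIV. of_real (\<omega> i * \<omega> j) * (p i * q j))
        (\<Sum>i\<in>UNIV. \<Sum>j\<in>UNIV. of_real (of_bool (i = j)) * (p i * q j))"
      by (intro has_bochner_integral_sum has_bochner_integral_mult_left)
    moreover have "(\<Sum>j\<in>UNIV. of_real (of_bool (i = j)) * (p i * q j)) = p i * q i" for i
      by (simp add: of_bool_def if_distrib[of "\<lambda>x. x * _"] if_distrib[of of_real] cong: if_cong)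
    ultimately show ?thesis by (simp add: sum_product mult_ac)
  qed
  have sum_v: "(\<Sum>j\<in>UNIV. F j) = (\<Sum>x\<in>UNIV. F (x, True) + F (x, False))" for F :: "'x \<times> bool \<Rightarrow> complex"
    by (simp add: UNIV_Times_UNIV[symmetric] sum.cartesian_product' UNIV_bool add.commute del: UNIV_Times_UNIV)
  have sqrt2: "complex_of_real (sqrt 2) * complex_of_real (sqrt 2) = 2"
    by (simp flip: of_real_mult)
  have "(LINT a|\<mu>. a $ i * a $ i') = 0" for i i'
  proof -
    have "(LINT a|\<mu>. a $ i * a $ i') = (LINT \<omega>|N. h \<omega> $ i * h \<omega> $ i')"
      unfolding \<mu>_def
      by (subst integral_distr) (auto intro!: borel_measurable_continuous_onI continuous_intros)
    also have "\<dots> = (\<Sum>j\<in>UNIV. v j $ i * v j $ i')"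
      unfolding comp by (rule has_bochner_integral_integral_eq[OF cov])
    also have "\<dots> = 0" unfolding sum_v by (simp add: v_def sqrt2 mult_ac)
    finally show ?thesis .
  qed
  moreover have "(LINT a|\<mu>. a $ i * cnj (a $ i')) = \<Lambda> $ i $ i'" for i i'
  proof -
    have "(LINT a|\<mu>. a $ i * cnj (a $ i')) = (LINT \<omega>|N. h \<omega> $ i * cnj (h \<omega> $ i'))"
      unfolding \<mu>_def
      by (subst integral_distr) (auto intro!: borel_measurable_continuous_onI continuous_intros)
    also have "\<dots> = (\<Sum>j\<in>UNIV. v j $ i * cnj (v j $ i'))"
      unfolding comp cnj_sum complex_cnj_mult complex_cnj_complex_of_real
      by (rule has_bochner_integral_integral_eq[OF cov])
    also have "\<dots> = \<Lambda> $ i $ i'"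
      unfolding sum_v \<Lambda> by (intro sum.cong) (simp_all add: v_def sqrt2 field_simps)
    finally show ?thesis .
  qed
  moreover have "prob_space \<mu>" unfolding \<mu>_def by (rule N.prob_space_distr) simp
  moreover have "sets \<mu> = sets borel" by (simp add: \<mu>_def)
  ultimately have "centered_complex_gaussian \<Lambda> \<mu>"
    unfolding centered_complex_gaussian_def using gauss
    by (auto simp: Let_def intro!: exI[of _ "sqrt (\<Sum>j\<in>UNIV. (v j \<bullet> _)\<^sup>2)"] sum_nonneg)
  then show ?thesis ..
qed

text \<open>A Hermitian diagonally dominant matrix is an explicit sum of positive rank-one matrices,
  one for each pair of indices and one for each diagonal entry, which gives a factorization without
  spectral theory.\<close>

lemma diagonally_dominant_factorization:
  fixes \<Lambda> :: "complex ^ 'i::finite ^ 'i"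
  assumes herm: "\<And>a b. \<Lambda> $ b $ a = cnj (\<Lambda> $ a $ b)"
    and dom: "\<And>a. (\<Sum>b\<in>UNIV - {a}. norm (\<Lambda> $ a $ b)) \<le> Re (\<Lambda> $ a $ a)"
  obtains T :: "'i \<Rightarrow> 'i \<times> 'i \<Rightarrow> complex" where "\<And>a b. \<Lambda> $ a $ b = (\<Sum>x\<in>UNIV. T a x * cnj (T b x))"
proof
  define w where "w i = sqrt (Re (\<Lambda> $ i $ i) - (\<Sum>b\<in>UNIV - {i}. norm (\<Lambda> $ i $ b)))" for i
  \<comment> \<open>The column for (i, j) is supported on i and j; its outer product reproduces the
    off-diagonal entries and spends |\<Lambda> i j| of the diagonal budget at both ends. The factor
    1/2 is there because each unordered pair occurs twice. The columns (i, i) carry the slack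
    \<open>w\<close> of row i, which dominance makes real.\<close>
  define T where "T a x = (case x of (i, j) \<Rightarrow>
     if i = j then of_bool (a = i) * of_real (w i)
     else of_real (sqrt (norm (\<Lambda> $ i $ j) / 2)) * (of_bool (a = i) + of_bool (a = j) * cnj (sgn (\<Lambda> $ i $ j))))" for a x
  fix a b
  have w: "of_real (w i) * of_real (w i) = (of_real (Re (\<Lambda> $ i $ i) - (\<Sum>b\<in>UNIV - {i}. norm (\<Lambda> $ i $ b))) :: complex)" for i
    using dom[of i] by (simp add: w_def flip: of_real_mult)
  have s: "of_real (sqrt (norm z / 2)) * of_real (sqrt (norm z / 2)) = (of_real (norm z) / 2 :: complex)" for z :: complex
    by (simp flip: of_real_mult)
  have sg: "of_real (norm z) * sgn z = z" "sgn z * cnj (sgn z) * of_real (norm z) = of_real (norm z)" for z :: complex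
    by (auto simp: sgn_eq scaleR_conv_of_real divide_simps complex_norm_square[symmetric] power2_eq_square)
  have sg3: "cnj (sgn z) * of_real (norm z) = cnj z" for z :: complex
    by (metis sg(1) complex_cnj_mult complex_cnj_complex_of_real mult.commute)
  let ?t = "\<lambda>i j. T a (i, j) * cnj (T b (i, j))"
  have off: "?t i j = (of_bool (a = i \<and> b = i) + of_bool (a = j \<and> b = j)) * of_real (norm (\<Lambda> $ i $ j)) / 2
      + of_bool (a = i \<and> b = j) * \<Lambda> $ i $ j / 2 + of_bool (a = j \<and> b = i) * \<Lambda> $ j $ i / 2" if "i \<noteq> j" for i j
  proof -
    let ?z = "\<Lambda> $ i $ j"
    have "?t i j = (of_real (norm ?z) / 2) * ((of_bool (a = i) + of_bool (a = j) * cnj (sgn ?z))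
        * (of_bool (b = i) + of_bool (b = j) * sgn ?z))"
      using that s[of ?z] by (simp add: T_def mult_ac)
    also have "\<dots> = (of_bool (a = i \<and> b = i) + of_bool (a = j \<and> b = j)) * of_real (norm ?z) / 2
      + of_bool (a = i \<and> b = j) * ?z / 2 + of_bool (a = j \<and> b = i) * cnj ?z / 2"
      using sg[of ?z] sg3[of ?z] that
      by (auto simp: of_bool_def field_simps)
    finally show ?thesis using herm[of j i] by simp
  qed
  have diag: "?t i i = of_bool (a = i \<and> b = i) * of_real (Re (\<Lambda> $ i $ i) - (\<Sum>b\<in>UNIV - {i}. norm (\<Lambda> $ i $ b)))" for i
    using w[of i] by (auto simp: T_def)
  have real: "of_real (Re (\<Lambda> $ i $ i)) = \<Lambda> $ i $ i" for i
    using herm[of i i] by (metis Reals_cnj_iff of_real_Re)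
  have nsym: "norm (\<Lambda> $ i $ j) = norm (\<Lambda> $ j $ i)" for i j
    using herm[of i j] by simp
  have "(\<Sum>x\<in>UNIV. T a x * cnj (T b x)) = (\<Sum>i\<in>UNIV. \<Sum>j\<in>UNIV. ?t i j)"
    by (simp add: sum.cartesian_product UNIV_Times_UNIV[symmetric] case_prod_beta del: UNIV_Times_UNIV)
  also have "\<dots> = (\<Sum>i\<in>UNIV. ?t i i + (\<Sum>j\<in>UNIV - {i}. ?t i j))"
    by (intro sum.cong refl sum.remove) auto
  also have "\<dots> = (\<Sum>i\<in>UNIV. ?t i i) + (\<Sum>i\<in>UNIV. \<Sum>j\<in>UNIV - {i}. ?t i j)"
    by (rule sum.distrib)
  also have "(\<Sum>i\<in>UNIV. ?t i i) = of_bool (a = b) * (\<Lambda> $ a $ a - (\<Sum>j\<in>UNIV - {a}. of_real (norm (\<Lambda> $ a $ j))))"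
    unfolding diag
    by (cases "a = b") (auto simp: of_bool_def real if_distrib[of "\<lambda>x. x * _"] intro!: sum.neutral cong: if_cong)
  also have "(\<Sum>i\<in>UNIV. \<Sum>j\<in>UNIV - {i}. ?t i j) = of_bool (a = b) * (\<Sum>j\<in>UNIV - {a}. of_real (norm (\<Lambda> $ a $ j)))
     + of_bool (a \<noteq> b) * \<Lambda> $ a $ b"
  proof -
    \<comment> \<open>Half of the symmetric summand: \<open>?t i j\<close> is Q i j + Q j i, so the
      double sum is twice that of Q, and Q lives only in row i = a.\<close>
    define Q :: "'i \<Rightarrow> 'i \<Rightarrow> complex" where "Q i j = of_bool (a = i \<and> b = i) * of_real (norm (\<Lambda> $ i $ j)) / 2 + of_bool (a = i \<and> b = j) * \<Lambda> $ i $ j / 2" for i j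
    have swap: "(\<Sum>i\<in>UNIV. \<Sum>j\<in>UNIV - {i}. F i j) = (\<Sum>i\<in>UNIV. \<Sum>j\<in>UNIV - {i}. F j i)" for F :: "'i \<Rightarrow> 'i \<Rightarrow> complex"
    proof -
      have restrict: "(\<Sum>j\<in>UNIV - {i}. G i j) = (\<Sum>j\<in>UNIV. if i = j then 0 else G i j)" for G :: "'i \<Rightarrow> 'i \<Rightarrow> complex" and i
        by (rule sum.mono_neutral_cong_left) auto
      have "(\<Sum>i\<in>UNIV. \<Sum>j\<in>UNIV - {i}. F i j) = (\<Sum>i\<in>UNIV. \<Sum>j\<in>UNIV. if i = j then 0 else F i j)"
        by (simp only: restrict)
      also have "\<dots> = (\<Sum>i\<in>UNIV. \<Sum>j\<in>UNIV. if j = i then 0 else F j i)"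
        by (rule sum.swap)
      also have "\<dots> = (\<Sum>i\<in>UNIV. \<Sum>j\<in>UNIV - {i}. F j i)"
        by (simp only: restrict[of "\<lambda>i j. F j i"] eq_commute)
      finally show ?thesis .
    qed
    have row: "(\<Sum>j\<in>UNIV - {i}. Q i j) = (if i = a then of_bool (a = b) * (\<Sum>j\<in>UNIV - {a}. of_real (norm (\<Lambda> $ a $ j))) / 2
         + of_bool (a \<noteq> b) * \<Lambda> $ a $ b / 2 else 0)" for i
    proof (cases "a = b")
      case True
      then show ?thesis by (auto simp: Q_def sum_divide_distrib intro!: sum.cong sum.neutral)
    next
      case False
      then have "(\<Sum>j\<in>UNIV - {i}. Q i j) = (\<Sum>j\<in>UNIV - {i}. if j = b then of_bool (a = i) * \<Lambda> $ i $ b / 2 else 0)"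
        by (intro sum.cong) (auto simp: Q_def)
      then show ?thesis using False by auto
    qed
    have "(\<Sum>i\<in>UNIV. \<Sum>j\<in>UNIV - {i}. ?t i j) = (\<Sum>i\<in>UNIV. \<Sum>j\<in>UNIV - {i}. Q i j + Q j i)"
    proof (intro sum.cong refl)
      fix i j :: 'i assume "j \<in> UNIV - {i}"
      then have "i \<noteq> j" by auto
      then show "?t i j = Q i j + Q j i"
        unfolding off[OF \<open>i \<noteq> j\<close>] Q_def nsym[of j i]
        by (simp only: add_divide_distrib distrib_right) (simp only: ac_simps)
    qed
    also have "\<dots> = 2 * (\<Sum>i\<in>UNIV. \<Sum>j\<in>UNIV - {i}. Q i j)"
      by (simp add: sum.distrib swap[of "\<lambda>i j. Q j i"])
    finally show ?thesis unfolding row by (simp add: distrib_left)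
  qed
  finally show "\<Lambda> $ a $ b = (\<Sum>x\<in>UNIV. T a x * cnj (T b x))"
    by (cases "a = b") auto
qed

section \<open>The determinant expectation as a polynomial in the covariance\<close>

text \<open>If q is not injective, composing with a transposition inside a fibre of q keeps the
  condition and flips the sign, so the sum equals its own negative. For injective q only the
  identity survives.\<close>

lemma sum_sign_stabilizer:
  fixes q :: "'k::finite \<Rightarrow> 'm"
  shows "(\<Sum>s | s permutes UNIV. of_int (sign s) * of_bool (\<forall>j. q (s j) = q j)) = (of_bool (inj q) :: complex)"
proof (cases "inj q")
  case True
  then have "(\<forall>j. q (s j) = q j) \<longleftrightarrow> s = id" for s :: "'k \<Rightarrow> 'k"
    by (auto simp: inj_eq)
  then have "(\<Sum>s | s permutes UNIV. of_int (sign s) * of_bool (\<forall>j. q (s j) = q j))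
      = (\<Sum>s \<in> {s. s permutes (UNIV :: 'k set)}. if s = id then 1 else 0 :: complex)"
    by (intro sum.cong) (auto simp: sign_id)
  also have "\<dots> = 1" by (simp add: permutes_id finite_permutations)
  finally show ?thesis using True by simp
next
  case False
  then obtain a b where ab: "a \<noteq> b" "q a = q b" by (auto simp: inj_def)
  let ?t = "Transposition.transpose a b"
  let ?S = "\<Sum>s | s permutes UNIV. of_int (sign s) * of_bool (\<forall>j. q (s j) = q j) :: complex"
  have qt: "q (?t x) = q x" for x using ab by (auto simp: Transposition.transpose_def)
  have t: "?t permutes UNIV" by (rule permutes_swap_id) auto
  have "sign (?t \<circ> s) = - sign s" if "s permutes (UNIV :: 'k set)" for s
    using that ab(1) by (simp add: sign_compose permutation_swap_id permutes_imp_permutation[OF finite] sign_swap_id)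
  then have "?S = (\<Sum>s | s permutes UNIV. - (of_int (sign s) * of_bool (\<forall>j. q (s j) = q j)))"
    by (intro sum.reindex_bij_witness[of _ "\<lambda>s. ?t \<circ> s" "\<lambda>s. ?t \<circ> s"])
       (auto simp: qt permutes_compose[OF _ t] simp flip: comp_assoc)
  also have "\<dots> = - ?S" by (simp add: sum_negf)
  finally show ?thesis using False by simp
qed

text \<open>A pair x = (p, j) numbers the factors obtained by expanding all n determinants: p is the
  point, j the row, and q chooses the inner summation index of the matrix product. This indexes the
  unconjugated coordinate of factor x; \<open>col_index\<close> indexes the conjugated one, whose
  row has been moved by the Leibniz permutation of block p.\<close>

definition row_index :: "('n \<times> 'k \<Rightarrow> 'm) \<Rightarrow> 'n \<times> 'k \<Rightarrow> 'k \<times> 'n \<times> 'm" where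
  "row_index q x = (snd x, fst x, q x)"

definition col_index :: "('n \<Rightarrow> 'k \<Rightarrow> 'k) \<Rightarrow> ('n \<times> 'k \<Rightarrow> 'm) \<Rightarrow> 'n \<times> 'k \<Rightarrow> 'k \<times> 'n \<times> 'm" where
  "col_index \<sigma> q x = (\<sigma> (fst x) (snd x), fst x, q x)"

text \<open>The Wick expansion of the expected product of determinants, defined for arbitrary
  matrices so that it can be rescaled and compared with the identity without reference to a
  measure.\<close>

definition wick_sum :: "complex ^ ('k::finite \<times> 'n::finite \<times> 'm::finite) ^ ('k \<times> 'n \<times> 'm) \<Rightarrow> complex" where
  "wick_sum \<Lambda> = (\<Sum>\<sigma> | \<forall>p. \<sigma> p permutes UNIV. (\<Prod>p\<in>UNIV. of_int (sign (\<sigma> p))) *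
     (\<Sum>q\<in>UNIV. \<Sum>\<pi> | bij \<pi>. \<Prod>x\<in>UNIV. \<Lambda> $ row_index q x $ col_index \<sigma> q (\<pi> x)))"

lemma prod_sum_families:
  fixes f :: "'p::finite \<Rightarrow> 'b::finite \<Rightarrow> 'c::comm_semiring_1"
  shows "(\<Prod>p\<in>UNIV. \<Sum>y | P y. f p y) = (\<Sum>g | \<forall>p. P (g p). \<Prod>p\<in>UNIV. f p (g p))"
proof -
  have "PiE UNIV (\<lambda>_. {y. P y}) = {g::'p \<Rightarrow> 'b. \<forall>p. P (g p)}" by auto
  then show ?thesis by (simp add: prod_sum_PiE)
qed

lemma prod_pairs:
  fixes f :: "'a::finite \<times> 'b::finite \<Rightarrow> 'c::comm_monoid_mult"
  shows "(\<Prod>p\<in>UNIV. \<Prod>j\<in>UNIV. f (p, j)) = (\<Prod>x\<in>UNIV. f x)"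
  by (simp add: prod.cartesian_product UNIV_Times_UNIV[symmetric] case_prod_beta del: UNIV_Times_UNIV)

lemma prod_det_block:
  fixes a :: "complex ^ ('k::finite \<times> 'n::finite \<times> 'm::finite)"
  shows "(\<Prod>p\<in>UNIV. det (block a p ** conj_transpose (block a p))) =
    (\<Sum>\<sigma> | \<forall>p. \<sigma> p permutes UNIV. (\<Prod>p\<in>UNIV. of_int (sign (\<sigma> p))) *
      (\<Sum>q\<in>UNIV. \<Prod>x\<in>UNIV. a $ row_index q x * cnj (a $ col_index \<sigma> q x)))"
proof -
  let ?e = "\<lambda>\<sigma> x q. a $ (snd x, fst x, q) * cnj (a $ (\<sigma> (fst x) (snd x), fst x, q))"
  have "(\<Prod>p\<in>UNIV. det (block a p ** conj_transpose (block a p))) =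
     (\<Prod>p\<in>UNIV. \<Sum>s | s permutes UNIV. of_int (sign s) * (\<Prod>j\<in>UNIV. \<Sum>q\<in>UNIV. a $ (j, p, q) * cnj (a $ (s j, p, q))))"
    by (simp add: det_def matrix_matrix_mult_def conj_transpose_def block_def)
  also have "\<dots> = (\<Sum>\<sigma> | \<forall>p. \<sigma> p permutes UNIV. \<Prod>p\<in>UNIV. of_int (sign (\<sigma> p)) *
      (\<Prod>j\<in>UNIV. \<Sum>q\<in>UNIV. a $ (j, p, q) * cnj (a $ (\<sigma> p j, p, q))))"
    by (rule prod_sum_families)
  also have "\<dots> = (\<Sum>\<sigma> | \<forall>p. \<sigma> p permutes UNIV. (\<Prod>p\<in>UNIV. of_int (sign (\<sigma> p))) *
      (\<Prod>x\<in>UNIV. \<Sum>q\<in>UNIV. ?e \<sigma> x q))"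
    by (simp add: prod.distrib prod_pairs[of "\<lambda>x. \<Sum>q\<in>UNIV. ?e _ x q", symmetric])
  also have "\<dots> = (\<Sum>\<sigma> | \<forall>p. \<sigma> p permutes UNIV. (\<Prod>p\<in>UNIV. of_int (sign (\<sigma> p))) *
      (\<Sum>q\<in>UNIV. \<Prod>x\<in>UNIV. ?e \<sigma> x (q x)))"
    by (simp add: prod_sum_families[where P = "\<lambda>_. True", simplified])
  finally show ?thesis by (simp add: row_index_def col_index_def)
qed

lemma gaussian_expectation_eq_wick_sum:
  fixes \<Lambda> :: "complex ^ ('k::finite \<times> 'n::finite \<times> 'm::finite) ^ ('k \<times> 'n \<times> 'm)"
  assumes "\<exists>\<mu>. centered_complex_gaussian \<Lambda> \<mu>"
  shows "gaussian_expectation \<Lambda> (\<lambda>a. \<Prod>p\<in>UNIV. det (block a p ** conj_transpose (block a p))) = wick_sum \<Lambda>"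
proof -
  define \<mu> where "\<mu> = (SOME \<mu>. centered_complex_gaussian \<Lambda> \<mu>)"
  interpret complex_gaussian \<Lambda> \<mu>
    using someI_ex[OF assms] by unfold_locales (simp add: \<mu>_def)
  have "gaussian_expectation \<Lambda> (\<lambda>a. \<Prod>p\<in>UNIV. det (block a p ** conj_transpose (block a p))) =
    (\<Sum>\<sigma> | \<forall>p. \<sigma> p permutes UNIV. (\<Prod>p\<in>UNIV. of_int (sign (\<sigma> p))) *
      (\<Sum>q\<in>UNIV. LINT a|\<mu>. (\<Prod>x\<in>UNIV. a $ row_index q x * cnj (a $ col_index \<sigma> q x))))"
    unfolding gaussian_expectation_def \<mu>_def[symmetric] prod_det_block
    by (simp add: Bochner_Integration.integral_sum integrable_wick)
  then show ?thesis by (simp only: wick wick_sum_def)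
qed

text \<open>For standard coordinates the blocks are independent and each contributes the expectation
  of det of a Gram matrix, the number of injections, which is m! / (m - k)! for k \<le> m. It is the
  limiting numerator and also gives the one-point function.\<close>

lemma wick_sum_identity:
  "wick_sum (mat 1 :: complex ^ ('k::finite \<times> 'n::finite \<times> 'm::finite) ^ ('k \<times> 'n \<times> 'm)) =
     of_nat (card {h :: 'k \<Rightarrow> 'm. inj h}) ^ CARD('n)"
proof -
  let ?I = "mat 1 :: complex ^ ('k \<times> 'n \<times> 'm) ^ ('k \<times> 'n \<times> 'm)"
  have perms: "(\<Sum>\<pi> | bij \<pi>. \<Prod>x\<in>UNIV. ?I $ row_index q x $ col_index \<sigma> q (\<pi> x)) =
      (\<Prod>p\<in>UNIV. of_bool (\<forall>j. q (p, \<sigma> p j) = q (p, j)))"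
    if \<sigma>: "\<forall>p. \<sigma> p permutes UNIV" for q \<sigma>
  proof -
    \<comment> \<open>The identity matrix forces row and column index to agree, so for given
      \<sigma> and q at most the pairing \<pi> = inv \<tau> survives, and only if q is constant
      along \<tau>. That condition splits over the points, leaving a sum over stabilizers for each
      p.\<close>
    define \<tau> where "\<tau> x = (fst x, \<sigma> (fst x) (snd x))" for x :: "'n \<times> 'k"
    have bij_\<sigma>: "bij (\<sigma> p)" for p using \<sigma> permutes_bij by blast
    have "inj \<tau>"
      using bij_is_inj[OF bij_\<sigma>] by (auto simp: \<tau>_def inj_def prod_eq_iff)
    then have \<tau>: "bij \<tau>" by (simp add: bij_def finite_UNIV_inj_surj)
    have "(\<Prod>x\<in>UNIV. ?I $ row_index q x $ col_index \<sigma> q (\<pi> x)) = of_bool (\<pi> = inv \<tau>) * of_bool (\<forall>y. q (\<tau> y) = q y)"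
      if \<pi>: "bij \<pi>" for \<pi>
    proof -
      have "(\<Prod>x\<in>UNIV. ?I $ row_index q x $ col_index \<sigma> q (\<pi> x)) = of_bool (\<forall>x. row_index q x = col_index \<sigma> q (\<pi> x))"
        by (auto simp: mat_def intro!: prod.neutral prod_zero)
      moreover have "row_index q x = col_index \<sigma> q (\<pi> x) \<longleftrightarrow> x = \<tau> (\<pi> x) \<and> q x = q (\<pi> x)" for x
        by (auto simp: row_index_def col_index_def \<tau>_def prod_eq_iff)
      moreover have "(\<forall>x. x = \<tau> (\<pi> x)) \<longleftrightarrow> \<pi> = inv \<tau>"
        using bij_inv_eq_iff[OF \<tau>] by (metis ext)
      moreover have inv: "(\<forall>x. q x = q (inv \<tau> x)) \<longleftrightarrow> (\<forall>y. q (\<tau> y) = q y)"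
        by (metis \<tau> bij_inv_eq_iff)
      ultimately have "(\<Prod>x\<in>UNIV. ?I $ row_index q x $ col_index \<sigma> q (\<pi> x)) = of_bool (\<pi> = inv \<tau> \<and> (\<forall>x. q x = q (\<pi> x)))"
        by (simp only: all_conj_distrib)
      also have "(\<pi> = inv \<tau> \<and> (\<forall>x. q x = q (\<pi> x))) \<longleftrightarrow> \<pi> = inv \<tau> \<and> (\<forall>y. q (\<tau> y) = q y)"
        using inv by blast
      finally show ?thesis by simp
    qed
    then have "(\<Sum>\<pi> | bij \<pi>. \<Prod>x\<in>UNIV. ?I $ row_index q x $ col_index \<sigma> q (\<pi> x))
        = (\<Sum>\<pi> \<in> {\<pi>. bij \<pi>}. if \<pi> = inv \<tau> then of_bool (\<forall>y. q (\<tau> y) = q y) else 0)"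
      by (intro sum.cong) auto
    also have "\<dots> = of_bool (\<forall>y. q (\<tau> y) = q y)"
      using bij_imp_bij_inv[OF \<tau>] by simp
    also have "\<dots> = (\<Prod>p\<in>UNIV. of_bool (\<forall>j. q (p, \<sigma> p j) = q (p, j)))"
      by (auto simp: \<tau>_def intro!: prod.neutral[symmetric] prod_zero)
    finally show ?thesis .
  qed
  have "wick_sum ?I = (\<Sum>\<sigma> | \<forall>p. \<sigma> p permutes UNIV. \<Sum>q\<in>(UNIV :: ('n \<times> 'k \<Rightarrow> 'm) set).
      \<Prod>p\<in>UNIV. of_int (sign (\<sigma> p)) * of_bool (\<forall>j. q (p, \<sigma> p j) = q (p, j)))"
    unfolding wick_sum_def by (intro sum.cong refl) (simp add: perms prod.distrib sum_distrib_left)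
  also have "\<dots> = (\<Sum>q\<in>(UNIV :: ('n \<times> 'k \<Rightarrow> 'm) set). \<Prod>p\<in>UNIV. \<Sum>s | s permutes UNIV. of_int (sign s) * of_bool (\<forall>j. q (p, s j) = q (p, j)))"
    by (subst sum.swap) (simp only: prod_sum_families)
  also have "\<dots> = (\<Sum>q\<in>(UNIV :: ('n \<times> 'k \<Rightarrow> 'm) set). \<Prod>p\<in>UNIV. of_bool (inj (\<lambda>j. q (p, j))))"
    by (intro sum.cong prod.cong refl sum_sign_stabilizer)
  also have "\<dots> = (\<Sum>Q\<in>(UNIV :: ('n \<Rightarrow> 'k \<Rightarrow> 'm) set). \<Prod>p\<in>UNIV. of_bool (inj (Q p)))"
    by (rule sum.reindex_bij_witness[of _ case_prod curry]) (auto simp: curry_def)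
  also have "\<dots> = (\<Prod>p\<in>(UNIV :: 'n set). \<Sum>h\<in>(UNIV :: ('k \<Rightarrow> 'm) set). of_bool (inj h))"
    by (rule prod_sum_families[where P = "\<lambda>_. True", simplified, symmetric])
  also have "\<dots> = of_nat (card {h :: 'k \<Rightarrow> 'm. inj h}) ^ CARD('n)" by simp
  finally show ?thesis .
qed

text \<open>Here k \<le> m enters: it keeps the one-point function, by which one divides, from
  vanishing.\<close>

lemma card_injections_pos:
  assumes "CARD('k::finite) \<le> CARD('m::finite)"
  shows "card {h :: 'k \<Rightarrow> 'm. inj h} > 0"
proof -
  obtain h :: "'k \<Rightarrow> 'm" where "inj h"
    using card_le_inj[OF finite finite assms] by (metis inj_on_def UNIV_I)
  then show ?thesis by (auto simp: card_gt_0_iff)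
qed

text \<open>In a product over a permutation every index occurs once as a row and once as a column,
  so a diagonal rescaling contributes the same square for every permutation. It can thus be pulled
  out of both determinants and Wick sums.\<close>

lemma prod_rescale:
  fixes d :: "'s::finite \<Rightarrow> 'a::comm_monoid_mult"
  assumes "bij \<pi>"
  shows "(\<Prod>x\<in>UNIV. d x * d (\<pi> x) * f x) = (\<Prod>x\<in>UNIV. d x)\<^sup>2 * (\<Prod>x\<in>UNIV. f x)"
  using prod.reindex_bij_betw[OF assms, of d] by (simp add: prod.distrib power2_eq_square)

lemma wick_sum_rescale:
  fixes d :: "'n::finite \<Rightarrow> complex" and \<Lambda> \<Lambda>' :: "complex ^ ('k::finite \<times> 'n \<times> 'm::finite) ^ ('k \<times> 'n \<times> 'm)"
  assumes "\<And>a b. \<Lambda> $ a $ b = d (fst (snd a)) * d (fst (snd b)) * \<Lambda>' $ a $ b"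
  shows "wick_sum \<Lambda> = (\<Prod>p\<in>UNIV. d p ^ CARD('k))\<^sup>2 * wick_sum \<Lambda>'"
proof -
  have "(\<Prod>x\<in>(UNIV :: ('n \<times> 'k) set). d (fst x)) = (\<Prod>p\<in>UNIV. d p ^ CARD('k))"
    using prod_pairs[of "\<lambda>x :: 'n \<times> 'k. d (fst x)"] by simp
  then have "(\<Prod>x\<in>UNIV. \<Lambda> $ row_index q x $ col_index \<sigma> q (\<pi> x)) =
    (\<Prod>p\<in>UNIV. d p ^ CARD('k))\<^sup>2 * (\<Prod>x\<in>UNIV. \<Lambda>' $ row_index q x $ col_index \<sigma> q (\<pi> x))"
    if "bij \<pi>" for q \<sigma> \<pi>
    using prod_rescale[OF that, of "\<lambda>x. d (fst x)"] by (simp add: assms row_index_def col_index_def)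
  then show ?thesis by (simp add: wick_sum_def sum_distrib_left mult.left_commute)
qed

lemma det_rescale:
  fixes e :: "'s::finite \<Rightarrow> 'a::comm_ring_1"
  assumes "\<And>x y. M $ x $ y = e x * e y * M' $ x $ y"
  shows "det M = (\<Prod>x\<in>UNIV. e x)\<^sup>2 * det M'"
proof -
  have "(\<Prod>x\<in>UNIV. M $ x $ \<pi> x) = (\<Prod>x\<in>UNIV. e x)\<^sup>2 * (\<Prod>x\<in>UNIV. M' $ x $ \<pi> x)"
    if "\<pi> permutes UNIV" for \<pi>
    using prod_rescale[OF permutes_bij[OF that], of e] by (simp add: assms)
  then show ?thesis by (simp add: det_def sum_distrib_left mult.left_commute)
qed

section \<open>Perturbation of products and permutation sums\<close>

lemma prod_diff_bigo:
  fixes f :: "'s \<Rightarrow> 'z \<Rightarrow> complex" and h :: "'z \<Rightarrow> complex"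
  assumes "finite A" "\<And>x. x \<in> A \<Longrightarrow> (\<lambda>z. f x z - c x) \<in> O[F](h)" "h \<in> O[F](\<lambda>_. 1)"
  shows "(\<lambda>z. (\<Prod>x\<in>A. f x z) - (\<Prod>x\<in>A. c x)) \<in> O[F](h)"
  using assms(1,2)
proof (induction A)
  case (insert x A)
  have IH: "(\<lambda>z. (\<Prod>x\<in>A. f x z) - (\<Prod>x\<in>A. c x)) \<in> O[F](h)" using insert by simp
  \<comment> \<open>Telescoping replaces one factor at a time, which requires the remaining product
    to be bounded.\<close>
  have "(\<lambda>z. \<Prod>x\<in>A. f x z) \<in> O[F](\<lambda>_. 1)"
    using sum_in_bigo(1)[OF landau_o.big_trans[OF IH assms(3)], of "\<lambda>_. \<Prod>x\<in>A. c x"] by simp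
  then have "(\<lambda>z. (f x z - c x) * (\<Prod>x\<in>A. f x z)) \<in> O[F](\<lambda>z. h z * 1)"
    using insert by (intro landau_o.big.mult) auto
  moreover have "(\<lambda>z. c x * ((\<Prod>x\<in>A. f x z) - (\<Prod>x\<in>A. c x))) \<in> O[F](h)"
    using IH by simp
  ultimately have "(\<lambda>z. (f x z - c x) * (\<Prod>x\<in>A. f x z) + c x * ((\<Prod>x\<in>A. f x z) - (\<Prod>x\<in>A. c x))) \<in> O[F](h)"
    by (intro sum_in_bigo) auto
  then show ?case using insert by (simp add: algebra_simps)
qed auto

text \<open>A bijection that changes the label of one index changes the label of a second one, so that a
  product containing one off-diagonal factor contains two of them.\<close>

lemma prod_bij_diff_bigo:
  fixes f :: "'s::finite \<Rightarrow> 'z \<Rightarrow> complex" and g :: "'z \<Rightarrow> complex" and l :: "'s \<Rightarrow> 'l"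
  assumes \<pi>: "bij \<pi>" and g: "g \<in> O[F](\<lambda>_. 1)"
    and same: "\<And>x. l (\<pi> x) = l x \<Longrightarrow> (\<lambda>z. f x z - c x) \<in> O[F](\<lambda>z. (g z)\<^sup>2)"
    and diff: "\<And>x. l (\<pi> x) \<noteq> l x \<Longrightarrow> f x \<in> O[F](g)" "\<And>x. l (\<pi> x) \<noteq> l x \<Longrightarrow> c x = 0"
  shows "(\<lambda>z. (\<Prod>x\<in>UNIV. f x z) - (\<Prod>x\<in>UNIV. c x)) \<in> O[F](\<lambda>z. (g z)\<^sup>2)"
proof -
  have g2: "(\<lambda>z. (g z)\<^sup>2) \<in> O[F](\<lambda>_. 1)"
    using landau_o.big_power[OF g, of 2] by simp
  show ?thesis
  proof (cases "\<forall>x. l (\<pi> x) = l x")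
    case True
    then show ?thesis using same g2 by (intro prod_diff_bigo) auto
  next
    case False
    then obtain x where x: "l (\<pi> x) \<noteq> l x" by auto
    have "\<exists>y. y \<noteq> x \<and> l (\<pi> y) \<noteq> l y"
    proof (rule ccontr)
      assume *: "\<not> ?thesis"
      \<comment> \<open>Counting the indices with the label of x: \<pi> preserves the count, but if
        x were the only index whose label changes, the count would drop by exactly one.\<close>
      define h :: "'s \<Rightarrow> nat" where "h y = of_bool (l y = l x)" for y
      have "(\<Sum>y\<in>UNIV. h (\<pi> y)) = (\<Sum>y\<in>UNIV. h y)"
        by (rule sum.reindex_bij_betw[OF \<pi>])
      moreover have "(\<Sum>y\<in>UNIV. h (\<pi> y)) = h (\<pi> x) + (\<Sum>y\<in>UNIV - {x}. h (\<pi> y))"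
        by (rule sum.remove) auto
      moreover have "(\<Sum>y\<in>UNIV. h y) = h x + (\<Sum>y\<in>UNIV - {x}. h y)"
        by (rule sum.remove) auto
      moreover have "(\<Sum>y\<in>UNIV - {x}. h (\<pi> y)) = (\<Sum>y\<in>UNIV - {x}. h y)"
        using * by (intro sum.cong) (auto simp: h_def)
      ultimately show False using x by (simp add: h_def)
    qed
    then obtain y where y: "y \<noteq> x" "l (\<pi> y) \<noteq> l y" by auto
    have O1: "f v \<in> O[F](\<lambda>_. 1)" for v
    proof (cases "l (\<pi> v) = l v")
      case True
      then show ?thesis
        using sum_in_bigo(1)[OF landau_o.big_trans[OF same g2], of v "\<lambda>_. c v"] by simp
    next
      case False
      then show ?thesis using diff g landau_o.big_trans by blast
    qed
    have "(\<lambda>z. f x z * (f y z * (\<Prod>v\<in>UNIV - {x} - {y}. f v z))) \<in> O[F](\<lambda>z. g z * (g z * 1))"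
      using diff x y O1 by (intro landau_o.big.mult landau_o.big_prod_in_1) auto
    moreover have "(\<Prod>v\<in>UNIV. f v z) = f x z * (f y z * (\<Prod>v\<in>UNIV - {x} - {y}. f v z))" for z
      using y by (simp add: prod.remove[of UNIV x] prod.remove[of "UNIV - {x}" y])
    moreover have "(\<Prod>v\<in>UNIV. c v) = 0" using diff(2)[OF x] by (intro prod_zero) auto
    ultimately show ?thesis by (simp add: power2_eq_square del: prod_zero_iff)
  qed
qed

lemma det_diff_bigo:
  fixes M :: "'z \<Rightarrow> complex ^ 's::finite ^ 's"
  assumes g: "g \<in> O[F](\<lambda>_. 1)"
    and diag: "\<And>x. (\<lambda>z. M z $ x $ x - 1) \<in> O[F](\<lambda>z. (g z)\<^sup>2)"
    and off: "\<And>x y. x \<noteq> y \<Longrightarrow> (\<lambda>z. M z $ x $ y) \<in> O[F](g)"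
  shows "(\<lambda>z. det (M z) - 1) \<in> O[F](\<lambda>z. (g z)\<^sup>2)"
proof -
  let ?I = "mat 1 :: complex ^ 's ^ 's"
  have "(\<lambda>z. of_int (sign \<pi>) * ((\<Prod>x\<in>UNIV. M z $ x $ \<pi> x) - (\<Prod>x\<in>UNIV. ?I $ x $ \<pi> x))) \<in> O[F](\<lambda>z. (g z)\<^sup>2)"
    if "\<pi> permutes UNIV" for \<pi>
  proof -
    have "(\<lambda>z. (\<Prod>x\<in>UNIV. M z $ x $ \<pi> x) - (\<Prod>x\<in>UNIV. ?I $ x $ \<pi> x)) \<in> O[F](\<lambda>z. (g z)\<^sup>2)"
      \<comment> \<open>Labels are the indices themselves, so every moved index yields an
        off-diagonal factor.\<close>
      by (rule prod_bij_diff_bigo[where l = id, OF permutes_bij[OF that] g]) (auto simp: mat_def diag off)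
    then show ?thesis by simp
  qed
  then have "(\<lambda>z. \<Sum>\<pi> | \<pi> permutes UNIV. of_int (sign \<pi>) * ((\<Prod>x\<in>UNIV. M z $ x $ \<pi> x) - (\<Prod>x\<in>UNIV. ?I $ x $ \<pi> x)))
      \<in> O[F](\<lambda>z. (g z)\<^sup>2)"
    by (intro big_sum_in_bigo) auto
  moreover have "(\<Sum>\<pi> | \<pi> permutes UNIV. of_int (sign \<pi>) * ((\<Prod>x\<in>UNIV. M z $ x $ \<pi> x) - (\<Prod>x\<in>UNIV. ?I $ x $ \<pi> x)))
      = det (M z) - det ?I" for z
    unfolding det_def by (simp add: right_diff_distrib sum_subtractf)
  ultimately show ?thesis by simp
qed

lemma wick_sum_diff_bigo:
  fixes \<Lambda> :: "'z \<Rightarrow> complex ^ ('k::finite \<times> 'n::finite \<times> 'm::finite) ^ ('k \<times> 'n \<times> 'm)"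
  assumes g: "g \<in> O[F](\<lambda>_. 1)"
    and same: "\<And>j q j' q' p. (\<lambda>z. \<Lambda> z $ (j, p, q) $ (j', p, q') - of_bool (j = j' \<and> q = q')) \<in> O[F](\<lambda>z. (g z)\<^sup>2)"
    and diff: "\<And>j q j' q' p p'. p \<noteq> p' \<Longrightarrow> (\<lambda>z. \<Lambda> z $ (j, p, q) $ (j', p', q')) \<in> O[F](g)"
  shows "(\<lambda>z. wick_sum (\<Lambda> z) - of_nat (card {h :: 'k \<Rightarrow> 'm. inj h}) ^ CARD('n)) \<in> O[F](\<lambda>z. (g z)\<^sup>2)"
proof -
  let ?I = "mat 1 :: complex ^ ('k \<times> 'n \<times> 'm) ^ ('k \<times> 'n \<times> 'm)"
  let ?P = "\<lambda>M \<sigma> q \<pi>. \<Prod>x\<in>UNIV. M $ row_index q x $ col_index \<sigma> q (\<pi> x)"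
  have P: "(\<lambda>z. ?P (\<Lambda> z) \<sigma> q \<pi> - ?P ?I \<sigma> q \<pi>) \<in> O[F](\<lambda>z. (g z)\<^sup>2)" if "bij \<pi>" for \<sigma> q \<pi>
  \<comment> \<open>The label of a factor is its point. Both index maps preserve it, the Leibniz
    permutations acting only inside a block, so \<pi> changes the label exactly when the entry lies
    in an off-diagonal block.\<close>
  proof (rule prod_bij_diff_bigo[where l = fst, OF that g])
    fix x assume "fst (\<pi> x) = fst x"
    then show "(\<lambda>z. \<Lambda> z $ row_index q x $ col_index \<sigma> q (\<pi> x) - ?I $ row_index q x $ col_index \<sigma> q (\<pi> x)) \<in> O[F](\<lambda>z. (g z)\<^sup>2)"
      using same[of "snd x" "fst x" "q x"] by (simp add: row_index_def col_index_def mat_def of_bool_def)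
  next
    fix x assume "fst (\<pi> x) \<noteq> fst x"
    then show "(\<lambda>z. \<Lambda> z $ row_index q x $ col_index \<sigma> q (\<pi> x)) \<in> O[F](g)"
      "?I $ row_index q x $ col_index \<sigma> q (\<pi> x) = 0"
      using diff[of "fst x"] by (auto simp: row_index_def col_index_def mat_def)
  qed
  let ?c = "\<lambda>\<sigma> :: 'n \<Rightarrow> 'k \<Rightarrow> 'k. \<Prod>p\<in>UNIV. of_int (sign (\<sigma> p)) :: complex"
  have sum_P: "(\<lambda>z. \<Sum>q\<in>UNIV. \<Sum>\<pi> | bij \<pi>. ?P (\<Lambda> z) \<sigma> q \<pi> - ?P ?I \<sigma> q \<pi>) \<in> O[F](\<lambda>z. (g z)\<^sup>2)" for \<sigma>
    by (intro big_sum_in_bigo P) auto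
  have "(\<lambda>z. \<Sum>\<sigma> | \<forall>p. \<sigma> p permutes UNIV. ?c \<sigma> * (\<Sum>q\<in>UNIV. \<Sum>\<pi> | bij \<pi>. ?P (\<Lambda> z) \<sigma> q \<pi> - ?P ?I \<sigma> q \<pi>))
      \<in> O[F](\<lambda>z. (g z)\<^sup>2)"
    by (intro big_sum_in_bigo) (simp only: landau_o.big.cmult_in_iff cmult_in_bigo_iff sum_P simp_thms)
  moreover have "(\<Sum>\<sigma> | \<forall>p. \<sigma> p permutes UNIV. ?c \<sigma> * (\<Sum>q\<in>UNIV. \<Sum>\<pi> | bij \<pi>. ?P (\<Lambda> z) \<sigma> q \<pi> - ?P ?I \<sigma> q \<pi>))
      = wick_sum (\<Lambda> z) - wick_sum ?I" for z
    unfolding wick_sum_def by (simp add: sum_subtractf right_diff_distrib)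
  ultimately show ?thesis by (simp add: wick_sum_identity)
qed

section \<open>Normalised covariance matrices of far apart points\<close>

lemma matrix_inv_det_nz:
  fixes A :: "'a::field ^ 's::finite ^ 's"
  assumes "det A \<noteq> 0"
  shows "A ** matrix_inv A = mat 1" "matrix_inv A ** A = mat 1"
proof -
  have "\<exists>B. A ** B = mat 1 \<and> B ** A = mat 1"
    using assms by (simp add: invertible_det_nz[symmetric] invertible_def)
  then have "A ** matrix_inv A = mat 1 \<and> matrix_inv A ** A = mat 1"
    unfolding matrix_inv_def by (rule someI_ex)
  then show "A ** matrix_inv A = mat 1" "matrix_inv A ** A = mat 1" by auto
qed

lemma matrix_inv_unique:
  fixes A :: "'a::field ^ 's::finite ^ 's"
  assumes "det A \<noteq> 0" "A ** B = mat 1"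
  shows "matrix_inv A = B"
  by (metis assms matrix_inv_det_nz(2) matrix_mul_assoc matrix_mul_lid matrix_mul_rid)

lemma matrix_inv_hermitian:
  fixes A :: "complex ^ 's::finite ^ 's"
  assumes "det A \<noteq> 0" and herm: "\<And>u v. A $ v $ u = cnj (A $ u $ v)"
  shows "matrix_inv A $ v $ u = cnj (matrix_inv A $ u $ v)"
proof -
  have "(A ** conj_transpose (matrix_inv A)) $ i $ j = (mat 1 :: complex ^ 's ^ 's) $ i $ j" for i j
  proof -
    have "(A ** conj_transpose (matrix_inv A)) $ i $ j = cnj ((matrix_inv A ** A) $ j $ i)"
      using herm[of i] by (simp add: matrix_matrix_mult_def conj_transpose_def mult.commute)
    then show ?thesis by (simp add: matrix_inv_det_nz[OF assms(1)] mat_def)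
  qed
  then have "matrix_inv A = conj_transpose (matrix_inv A)"
    by (intro matrix_inv_unique assms) (simp add: vec_eq_iff)
  then show ?thesis by (metis (no_types) conj_transpose_def vec_lambda_beta)
qed

text \<open>By Cramer's rule an entry of the inverse is a polynomial in bounded entries divided by a
  determinant that tends to 1.\<close>

lemma matrix_inv_bigo:
  fixes M :: "'z \<Rightarrow> complex ^ 's::finite ^ 's"
  assumes entries: "\<And>x y. (\<lambda>z. M z $ x $ y) \<in> O[F](\<lambda>_. 1)" and det: "((\<lambda>z. det (M z)) \<longlongrightarrow> 1) F"
  shows "(\<lambda>z. matrix_inv (M z) $ u $ v) \<in> O[F](\<lambda>_. 1)"
proof -
  define K where "K z = det (\<chi> i j. if j = u then axis v 1 $ i else M z $ i $ j)" for z
  have nz: "\<forall>\<^sub>F z in F. det (M z) \<noteq> 0"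
    using tendsto_imp_eventually_ne[OF det, of 0] by simp
  have "((\<lambda>z. inverse (det (M z))) \<longlongrightarrow> inverse 1) F"
    using det by (rule tendsto_inverse) simp
  then have "(\<lambda>z. inverse (det (M z))) \<in> O[F](\<lambda>_. 1)"
    by (intro bigoI_tendsto[where c = 1]) auto
  moreover have "K \<in> O[F](\<lambda>_. 1)"
  proof -
    have "(\<lambda>z. \<Sum>\<pi> | \<pi> permutes UNIV. of_int (sign \<pi>) * (\<Prod>i\<in>UNIV. if \<pi> i = u then axis v 1 $ i else M z $ i $ \<pi> i)) \<in> O[F](\<lambda>_. 1)"
    proof (intro big_sum_in_bigo landau_o.big.mult_in_1 landau_o.big_prod_in_1)
      show "(\<lambda>z. if \<pi> i = u then axis v 1 $ i else M z $ i $ \<pi> i) \<in> O[F](\<lambda>_. 1)" for \<pi> i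
        using entries by (cases "\<pi> i = u") auto
    qed auto
    then show ?thesis unfolding K_def det_def by simp
  qed
  ultimately have "(\<lambda>z. K z * inverse (det (M z))) \<in> O[F](\<lambda>_. 1)"
    by (intro landau_o.big.mult_in_1)
  moreover have "\<forall>\<^sub>F z in F. matrix_inv (M z) $ u $ v = K z * inverse (det (M z))"
    using nz
  proof eventually_elim
    case (elim z)
    have "M z *v column v (matrix_inv (M z)) = axis v 1"
      using matrix_inv_det_nz(1)[OF elim]
      by (simp add: vec_eq_iff matrix_vector_mult_def matrix_matrix_mult_def column_def mat_def axis_def eq_commute)
    then have "column v (matrix_inv (M z)) = (\<chi> k. det (\<chi> i j. if j = k then axis v 1 $ i else M z $ i $ j) / det (M z))"
      using cramer[OF elim] by blast
    then have "column v (matrix_inv (M z)) $ u = K z / det (M z)"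
      by (simp add: K_def)
    then show ?case by (simp add: column_def field_simps)
  qed
  ultimately show ?thesis by (simp cong: landau_o.big.in_cong)
qed

text \<open>Subtracting multiples of conditioned values from the derivatives does not change the
  conditional covariance; here the derivative at \<open>u\<close> is recentred from \<open>s u\<close> to \<open>s u - s \<alpha>\<close>.\<close>

lemma schur_complement_shift:
  fixes A Ai :: "complex ^ 's::finite ^ 's"
  assumes inv: "A ** Ai = mat 1" "Ai ** A = mat 1" and herm: "\<And>u v. A $ v $ u = cnj (A $ u $ v)"
  shows "(\<Sum>v\<in>UNIV. (\<Sum>u\<in>UNIV. cnj (A $ u $ \<alpha> * s u) * Ai $ u $ v) * (A $ v $ \<beta> * t v)) =
    (\<Sum>u\<in>UNIV. \<Sum>v\<in>UNIV. cnj (A $ u $ \<alpha> * (s u - s \<alpha>)) * Ai $ u $ v * (A $ v $ \<beta> * (t v - t \<beta>))) +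
    A $ \<alpha> $ \<beta> * (cnj (s \<alpha>) * (t \<alpha> - t \<beta>) + cnj (s \<beta>) * t \<beta>)"
proof -
  have l: "(\<Sum>u\<in>UNIV. cnj (A $ u $ \<alpha>) * Ai $ u $ v) = of_bool (\<alpha> = v)" for v
    using arg_cong[OF inv(1), of "\<lambda>M. M $ \<alpha> $ v"] herm[of _ \<alpha>]
    by (simp add: matrix_matrix_mult_def mat_def of_bool_def)
  have r: "(\<Sum>v\<in>UNIV. Ai $ u $ v * A $ v $ \<beta>) = of_bool (u = \<beta>)" for u
    using arg_cong[OF inv(2), of "\<lambda>M. M $ u $ \<beta>"] by (simp add: matrix_matrix_mult_def mat_def of_bool_def)
  let ?b = "\<lambda>v. A $ v $ \<beta> * (t v - t \<beta>)" and ?a = "\<lambda>u. cnj (A $ u $ \<alpha> * (s u - s \<alpha>))"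
  have "(\<Sum>v\<in>UNIV. (\<Sum>u\<in>UNIV. cnj (A $ u $ \<alpha> * s u) * Ai $ u $ v) * (A $ v $ \<beta> * t v))
      = (\<Sum>u\<in>UNIV. cnj (A $ u $ \<alpha> * s u) * (\<Sum>v\<in>UNIV. Ai $ u $ v * (A $ v $ \<beta> * t v)))"
    by (simp only: sum_distrib_left sum_distrib_right mult.assoc) (rule sum.swap)
  also have "\<dots> = (\<Sum>u\<in>UNIV. cnj (A $ u $ \<alpha> * s u) * ((\<Sum>v\<in>UNIV. Ai $ u $ v * ?b v) + t \<beta> * of_bool (u = \<beta>)))"
    unfolding r[symmetric] by (simp add: sum_distrib_left algebra_simps flip: sum.distrib)
  also have "\<dots> = (\<Sum>u\<in>UNIV. cnj (A $ u $ \<alpha> * s u) * (\<Sum>v\<in>UNIV. Ai $ u $ v * ?b v)) + cnj (A $ \<beta> $ \<alpha> * s \<beta>) * t \<beta>"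
    by (simp add: distrib_left sum.distrib of_bool_def if_distrib[of "\<lambda>x. _ * x"] cong: if_cong)
  also have "(\<Sum>u\<in>UNIV. cnj (A $ u $ \<alpha> * s u) * (\<Sum>v\<in>UNIV. Ai $ u $ v * ?b v)) =
      (\<Sum>u\<in>UNIV. ?a u * (\<Sum>v\<in>UNIV. Ai $ u $ v * ?b v)) +
      cnj (s \<alpha>) * (\<Sum>u\<in>UNIV. cnj (A $ u $ \<alpha>) * (\<Sum>v\<in>UNIV. Ai $ u $ v * ?b v))"
    by (simp add: sum_distrib_left[of "cnj (s \<alpha>)"] algebra_simps flip: sum.distrib)
  also have "(\<Sum>u\<in>UNIV. cnj (A $ u $ \<alpha>) * (\<Sum>v\<in>UNIV. Ai $ u $ v * ?b v)) =
      (\<Sum>v\<in>UNIV. (\<Sum>u\<in>UNIV. cnj (A $ u $ \<alpha>) * Ai $ u $ v) * ?b v)"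
    by (simp only: sum_distrib_left sum_distrib_right mult.assoc) (rule sum.swap)
  also have "\<dots> = ?b \<alpha>"
    unfolding l by (simp add: of_bool_def if_distrib[of "\<lambda>x. x * _"] cong: if_cong)
  finally show ?thesis
    using herm[of \<alpha> \<beta>] by (simp add: sum_distrib_left mult.assoc algebra_simps)
qed

section \<open>Rescaled and recentred covariance matrices\<close>

text \<open>The square root of the diagonal entry exp(|z p|^2) of \<open>mat_A\<close>, so that
  division by two weights makes the diagonal equal to 1.\<close>

definition weight :: "('n \<Rightarrow> complex ^ 'm::finite) \<Rightarrow> 'n \<Rightarrow> complex" where
  "weight z p = of_real (exp ((norm (z p))\<^sup>2 / 2))"

definition normalized_A :: "('n::finite \<Rightarrow> complex ^ 'm::finite) \<Rightarrow> complex ^ ('k::finite \<times> 'n) ^ ('k \<times> 'n)" where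
  "normalized_A z = (\<chi> x y. mat_A z $ x $ y / (weight z (snd x) * weight z (snd y)))"

text \<open>The covariance of the value at one point with the covariant derivative at another. The
  coordinate difference makes it vanish when the two points have the same label.\<close>

definition normalized_B :: "('n::finite \<Rightarrow> complex ^ 'm::finite) \<Rightarrow> 'k::finite \<times> 'n \<Rightarrow> 'k \<times> 'n \<times> 'm \<Rightarrow> complex" where
  "normalized_B z u a = (case a of (j, p, q) \<Rightarrow> normalized_A z $ u $ (j, p) * (z (snd u) $ q - z p $ q))"

text \<open>The conditional covariance of covariant derivatives. The bracket is the recentred form
  of the bracket in \<open>mat_C\<close>: its two products of coordinates become one product of
  differences.\<close>

definition normalized_Lambda ::
  "('n::finite \<Rightarrow> complex ^ 'm::finite) \<Rightarrow> complex ^ ('k::finite \<times> 'n \<times> 'm) ^ ('k \<times> 'n \<times> 'm)" where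
  "normalized_Lambda z = (\<chi> a b. case (a, b) of ((j, p, q), (j', p', q')) \<Rightarrow>
     normalized_A z $ (j, p) $ (j', p') * (of_bool (q = q') + (cnj (z p' $ q) - cnj (z p $ q)) * (z p $ q' - z p' $ q'))
     - (\<Sum>u\<in>UNIV. \<Sum>v\<in>UNIV. cnj (normalized_B z u a) * matrix_inv (normalized_A z :: complex ^ ('k \<times> 'n) ^ ('k \<times> 'n)) $ u $ v * normalized_B z v b))"

lemma weight_nonzero [simp]: "weight z p \<noteq> 0"
  by (simp add: weight_def)

lemma cnj_weight [simp]: "cnj (weight z p) = weight z p"
  by (simp add: weight_def)

lemma mat_A_eq: "mat_A z $ x $ y = weight z (snd x) * weight z (snd y) * normalized_A z $ x $ y"
  by (simp add: normalized_A_def)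

lemma herm_dot_commute: "herm_dot w z = cnj (herm_dot z w)"
  by (simp add: herm_dot_def mult.commute)

lemma mat_A_hermitian: "mat_A z $ y $ x = cnj (mat_A z $ x $ y)"
  by (auto simp: mat_A_def exp_cnj[symmetric] split: prod.split) (metis exp_cnj herm_dot_commute)+

lemma normalized_A_hermitian: "normalized_A z $ y $ x = cnj (normalized_A z $ x $ y)"
  using mat_A_hermitian[of z y x] by (simp add: normalized_A_def mult.commute)

text \<open>The prefactor is the one that \<open>wick_sum_rescale\<close> yields for
  \<open>mat_Lambda\<close>, so the two cancel in the correlation function.\<close>

lemma det_mat_A:
  fixes z :: "'n::finite \<Rightarrow> complex ^ 'm::finite"
  shows "det (mat_A z :: complex ^ ('k::finite \<times> 'n) ^ ('k \<times> 'n)) =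
    (\<Prod>p\<in>UNIV. weight z p ^ CARD('k))\<^sup>2 * det (normalized_A z :: complex ^ ('k \<times> 'n) ^ ('k \<times> 'n))"
proof -
  have "(\<Prod>x\<in>(UNIV :: ('k \<times> 'n) set). weight z (snd x)) = (\<Prod>p\<in>UNIV. weight z p ^ CARD('k))"
    using prod_pairs[of "\<lambda>x :: 'k \<times> 'n. weight z (snd x)"] by (simp add: prod_power_distrib)
  then show ?thesis by (subst det_rescale[OF mat_A_eq]) simp
qed

lemma mat_Lambda_eq:
  fixes z :: "'n::finite \<Rightarrow> complex ^ 'm::finite" and a b :: "'k::finite \<times> 'n \<times> 'm"
  assumes det: "det (normalized_A z :: complex ^ ('k \<times> 'n) ^ ('k \<times> 'n)) \<noteq> 0"
  shows "mat_Lambda z $ a $ b = weight z (fst (snd a)) * weight z (fst (snd b)) * normalized_Lambda z $ a $ b"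
proof -
  let ?A = "mat_A z :: complex ^ ('k \<times> 'n) ^ ('k \<times> 'n)" and ?N = "normalized_A z :: complex ^ ('k \<times> 'n) ^ ('k \<times> 'n)"
  let ?w = "\<lambda>x :: 'k \<times> 'n. weight z (snd x)"
  have detA: "det ?A \<noteq> 0" using det unfolding det_mat_A by simp
  \<comment> \<open>Dividing a matrix by weights on both sides multiplies its inverse by them; this
    is checked by multiplying out and using uniqueness of the inverse.\<close>
  have inv: "matrix_inv ?N $ u $ v = ?w u * ?w v * matrix_inv ?A $ u $ v" for u v
  proof -
    have "?N ** (\<chi> u v. ?w u * ?w v * matrix_inv ?A $ u $ v) = mat 1"
    proof (simp add: vec_eq_iff, intro allI)
      fix i j
      have "(?N ** (\<chi> u v. ?w u * ?w v * matrix_inv ?A $ u $ v)) $ i $ j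
          = ?w j / ?w i * (?A ** matrix_inv ?A) $ i $ j"
        by (simp add: matrix_matrix_mult_def normalized_A_def sum_distrib_left field_simps)
      also have "\<dots> = (mat 1 :: complex ^ ('k \<times> 'n) ^ ('k \<times> 'n)) $ i $ j"
        by (simp add: matrix_inv_det_nz[OF detA] mat_def)
      finally show "(?N ** (\<chi> u v. ?w u * ?w v * matrix_inv ?A $ u $ v)) $ i $ j
          = (mat 1 :: complex ^ ('k \<times> 'n) ^ ('k \<times> 'n)) $ i $ j" .
    qed
    from matrix_inv_unique[OF det this] show ?thesis by simp
  qed
  obtain j p q where a: "a = (j, p, q)" by (cases a)
  obtain j' p' q' where b: "b = (j', p', q')" by (cases b)
  note ab = a b
  define \<alpha> \<beta> where "\<alpha> = (j, p)" and "\<beta> = (j', p')"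
  define s t where "s u = z (snd u) $ q" and "t u = z (snd u) $ q'" for u :: "'k \<times> 'n"
  have B: "mat_B z $ u $ a = ?A $ u $ \<alpha> * s u" "mat_B z $ u $ b = ?A $ u $ \<beta> * t u" for u
    by (auto simp: mat_B_def mat_A_def ab \<alpha>_def \<beta>_def s_def t_def split: prod.split)
  have C: "mat_C z $ a $ b = ?A $ \<alpha> $ \<beta> * (of_bool (q = q') + cnj (s \<beta>) * t \<alpha>)"
    by (simp add: mat_C_def mat_A_def ab \<alpha>_def \<beta>_def s_def t_def)
  have nB: "?A $ u $ \<alpha> * (s u - s \<alpha>) = ?w u * ?w \<alpha> * normalized_B z u a"
    "?A $ u $ \<beta> * (t u - t \<beta>) = ?w u * ?w \<beta> * normalized_B z u b" for u
    by (simp_all add: mat_A_eq normalized_B_def ab \<alpha>_def \<beta>_def s_def t_def)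
  have "mat_Lambda z $ a $ b = mat_C z $ a $ b
      - (\<Sum>v\<in>UNIV. (\<Sum>u\<in>UNIV. cnj (mat_B z $ u $ a) * matrix_inv ?A $ u $ v) * mat_B z $ v $ b)"
    by (simp add: mat_Lambda_def matrix_matrix_mult_def conj_transpose_def)
  also have "\<dots> = ?A $ \<alpha> $ \<beta> * (of_bool (q = q') + (cnj (s \<beta>) - cnj (s \<alpha>)) * (t \<alpha> - t \<beta>))
      - (\<Sum>u\<in>UNIV. \<Sum>v\<in>UNIV. cnj (?A $ u $ \<alpha> * (s u - s \<alpha>)) * matrix_inv ?A $ u $ v * (?A $ v $ \<beta> * (t v - t \<beta>)))"
    unfolding B C schur_complement_shift[OF matrix_inv_det_nz[OF detA] mat_A_hermitian]
    by (simp add: algebra_simps)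
  \<comment> \<open>The weights at the inner indices u and v are absorbed by the inverse; only those
    at \<alpha> and \<beta> remain outside.\<close>
  also have "(\<Sum>u\<in>UNIV. \<Sum>v\<in>UNIV. cnj (?A $ u $ \<alpha> * (s u - s \<alpha>)) * matrix_inv ?A $ u $ v * (?A $ v $ \<beta> * (t v - t \<beta>)))
      = ?w \<alpha> * ?w \<beta> * (\<Sum>u\<in>UNIV. \<Sum>v\<in>UNIV. cnj (normalized_B z u a) * matrix_inv ?N $ u $ v * normalized_B z v b)"
    unfolding nB inv sum_distrib_left by (intro sum.cong refl) simp
  finally show ?thesis
    by (simp add: normalized_Lambda_def mat_A_eq ab \<alpha>_def \<beta>_def s_def t_def right_diff_distrib)
qed

lemma normalized_Lambda_hermitian:
  fixes z :: "'n::finite \<Rightarrow> complex ^ 'm::finite" and a b :: "'k::finite \<times> 'n \<times> 'm"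
  assumes det: "det (normalized_A z :: complex ^ ('k \<times> 'n) ^ ('k \<times> 'n)) \<noteq> 0"
  shows "normalized_Lambda z $ b $ a = cnj (normalized_Lambda z $ a $ b)"
proof -
  let ?N = "normalized_A z :: complex ^ ('k \<times> 'n) ^ ('k \<times> 'n)"
  obtain j p q where a: "a = (j, p, q)" by (cases a)
  obtain j' p' q' where b: "b = (j', p', q')" by (cases b)
  note ab = a b
  have "(\<Sum>u\<in>UNIV. \<Sum>v\<in>UNIV. cnj (normalized_B z u b) * matrix_inv ?N $ u $ v * normalized_B z v a)
      = cnj (\<Sum>u\<in>UNIV. \<Sum>v\<in>UNIV. cnj (normalized_B z u a) * matrix_inv ?N $ u $ v * normalized_B z v b)"
    by (subst sum.swap) (simp add: matrix_inv_hermitian[OF det normalized_A_hermitian, symmetric] mult_ac)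
  then show ?thesis
    using normalized_A_hermitian[of z "(j', p')" "(j, p)"]
    by (simp add: normalized_Lambda_def ab eq_commute[of q'] algebra_simps)
qed

text \<open>The real part of the Hermitian product is the real inner product, and completing the
  square isolates the distance. This is the source of the Gaussian decay after
  normalisation.\<close>

lemma norm_exp_herm_dot:
  "norm (exp (herm_dot z w)) = exp ((norm z)\<^sup>2 / 2) * exp ((norm w)\<^sup>2 / 2) * exp (- (norm (z - w))\<^sup>2 / 2)"
proof -
  have "Re (herm_dot z w) = z \<bullet> w"
    by (simp add: herm_dot_def inner_vec_def inner_complex_def)
  moreover have "(norm (z - w))\<^sup>2 = (norm z)\<^sup>2 - 2 * (z \<bullet> w) + (norm w)\<^sup>2"
    by (simp add: power2_norm_eq_inner inner_diff_left inner_diff_right inner_commute)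
  ultimately show ?thesis
    by (simp flip: exp_add) (simp add: field_simps)
qed

lemma norm_normalized_A:
  "norm (normalized_A z $ (j, p) $ (j', p')) = of_bool (j = j') * exp (- (norm (z p - z p'))\<^sup>2 / 2)"
  by (simp add: normalized_A_def mat_A_def weight_def norm_mult norm_divide norm_exp_herm_dot del: norm_exp_eq_Re)

lemma normalized_A_same_point: "normalized_A z $ (j, p) $ (j', p) = of_bool (j = j')"
proof -
  have "herm_dot (z p) (z p) = of_real ((norm (z p))\<^sup>2)"
    by (simp add: herm_dot_def norm_vec_def L2_set_def sum_nonneg complex_mult_cnj cmod_power2)
  then have "exp (herm_dot (z p) (z p)) = of_real (exp ((norm (z p))\<^sup>2))"
    by (simp only: exp_of_real)
  also have "\<dots> = weight z p * weight z p"
    by (simp add: weight_def flip: of_real_mult exp_add)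
  finally show ?thesis
    by (simp add: normalized_A_def mat_A_def)
qed

section \<open>Estimates for large separation\<close>

text \<open>The common bound for all off-diagonal data; its square is the error term of the
  theorem.\<close>

definition decay :: "('n::finite \<Rightarrow> complex ^ 'm::finite) \<Rightarrow> real" where
  "decay z = (min_separation z)\<^sup>2 * exp (- (min_separation z)\<^sup>2 / 2)"

text \<open>Eventual properties along this filter hold uniformly for all sufficiently separated
  configurations, wherever the points lie.\<close>

abbreviation far :: "('n::finite \<Rightarrow> complex ^ 'm::finite) filter" where
  "far \<equiv> filtercomap min_separation at_top"

lemma min_separation_le:
  fixes z :: "'n::finite \<Rightarrow> complex ^ 'm::finite"
  assumes "p \<noteq> p'"
  shows "min_separation z \<le> norm (z p - z p')"
proof -
  have "{norm (z p - z p') | p p'. p \<noteq> p'} \<subseteq> (\<lambda>(p, p'). norm (z p - z p')) ` UNIV" by auto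
  then have "finite {norm (z p - z p') | p p'. p \<noteq> p'}" by (rule finite_subset) simp
  then show ?thesis unfolding min_separation_def using assms by (intro Min_le) auto
qed

text \<open>Individual distances may be much larger than the minimum, so the bound has to decrease
  in the distance. It does so from sqrt 2 on; the threshold 2 is a convenient choice, and 1 + u
  \<le> exp u with u = (t^2 - r^2) / 2 gives the comparison.\<close>

lemma gaussian_decay_antimono:
  fixes r t :: real
  assumes "2 \<le> r" "r \<le> t"
  shows "t\<^sup>2 * exp (- t\<^sup>2 / 2) \<le> r\<^sup>2 * exp (- r\<^sup>2 / 2)"
proof -
  have r: "2\<^sup>2 \<le> r\<^sup>2" using assms by (intro power_mono) auto
  have rt: "r\<^sup>2 \<le> t\<^sup>2" using assms by (intro power_mono) auto
  have "t\<^sup>2 / r\<^sup>2 = 1 + (t\<^sup>2 - r\<^sup>2) / r\<^sup>2" using assms by (simp add: field_simps)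
  also have "\<dots> \<le> 1 + (t\<^sup>2 - r\<^sup>2) / 2" using r rt by (intro add_left_mono divide_left_mono) auto
  also have "\<dots> \<le> exp ((t\<^sup>2 - r\<^sup>2) / 2)" by (rule exp_ge_add_one_self)
  also have "\<dots> = exp (- r\<^sup>2 / 2) / exp (- t\<^sup>2 / 2)" by (simp add: field_simps flip: exp_diff)
  finally show ?thesis using assms by (simp add: field_simps)
qed

lemma eventually_separated: "\<forall>\<^sub>F z in far. 2 \<le> min_separation z"
  using eventually_filtercomapI[OF eventually_ge_at_top[of "2::real"]] .

lemma decay_tendsto_zero: "(decay \<longlongrightarrow> 0) far"
proof -
  have "((\<lambda>r::real. r\<^sup>2 * exp (- r\<^sup>2 / 2)) \<longlongrightarrow> 0) at_top" by real_asymp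
  then show ?thesis
    unfolding decay_def by (rule filterlim_compose) (rule filterlim_filtercomap)
qed

lemma decay_smallo: "(\<lambda>z. of_real (decay z) :: complex) \<in> o[far](\<lambda>_. 1)"
  using tendsto_of_real[OF decay_tendsto_zero, where 'a = complex] by (intro smalloI_tendsto) auto

text \<open>The growth condition on \<phi> covers the three cases that occur: the constant 1, one
  coordinate difference, and the bracket of \<open>normalized_Lambda\<close>. The constant 2 comes
  from 1 + t^2 \<le> 2 t^2 for t \<ge> 1.\<close>

lemma off_diagonal_bigo:
  fixes \<phi> :: "('n::finite \<Rightarrow> complex ^ 'm::finite) \<Rightarrow> complex"
  assumes "p \<noteq> p'" and \<phi>: "\<And>z. norm (\<phi> z) \<le> 1 + (norm (z p - z p'))\<^sup>2"
  shows "(\<lambda>z. normalized_A z $ (j, p) $ (j', p') * \<phi> z) \<in> O[far](\<lambda>z. of_real (decay z))"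
proof (rule bigoI[where c = 2])
  show "\<forall>\<^sub>F z :: 'n \<Rightarrow> complex ^ 'm in far. norm (normalized_A z $ (j, p) $ (j', p') * \<phi> z) \<le> 2 * norm (complex_of_real (decay z))"
    using eventually_separated
  proof eventually_elim
    case (elim z)
    let ?t = "norm (z p - z p')"
    have t: "min_separation z \<le> ?t" by (rule min_separation_le) fact
    have "1 \<le> ?t\<^sup>2" using elim t by (intro one_le_power) simp
    then have "norm (\<phi> z) \<le> 2 * ?t\<^sup>2" using \<phi>[of z] by simp
    moreover have "norm (normalized_A z $ (j, p) $ (j', p')) \<le> exp (- ?t\<^sup>2 / 2)"
      by (simp add: norm_normalized_A)
    ultimately have "norm (normalized_A z $ (j, p) $ (j', p') * \<phi> z) \<le> exp (- ?t\<^sup>2 / 2) * (2 * ?t\<^sup>2)"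
      unfolding norm_mult by (intro mult_mono) auto
    also have "\<dots> \<le> 2 * decay z"
      using gaussian_decay_antimono[OF elim t] by (simp add: decay_def mult_ac)
    also have "decay z = norm (complex_of_real (decay z))"
      by (simp only: norm_of_real) (simp add: decay_def)
    finally show ?case .
  qed
qed

lemma normalized_A_off_diagonal:
  assumes "x \<noteq> y"
  shows "(\<lambda>z :: 'n::finite \<Rightarrow> complex ^ 'm::finite. normalized_A z $ x $ y) \<in> O[far](\<lambda>z. of_real (decay z))"
proof (cases "snd x = snd y")
  case True
  with assms have "normalized_A z $ x $ y = 0" for z :: "'n \<Rightarrow> complex ^ 'm"
    by (cases x; cases y) (auto simp: normalized_A_same_point)
  then show ?thesis by simp
next
  case False
  then show ?thesis
    using off_diagonal_bigo[of "snd x" "snd y" "\<lambda>_. 1" "fst x" "fst y"] by simp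
qed

lemma normalized_B_bigo:
  "(\<lambda>z :: 'n::finite \<Rightarrow> complex ^ 'm::finite. normalized_B z u a) \<in> O[far](\<lambda>z. of_real (decay z))"
proof -
  obtain j p q where a: "a = (j, p, q)" by (cases a)
  show ?thesis
  proof (cases "snd u = p")
    case True
    then show ?thesis by (simp add: normalized_B_def a)
  next
    case False
    have "norm (z (snd u) $ q - z p $ q) \<le> 1 + (norm (z (snd u) - z p))\<^sup>2" for z :: "'n \<Rightarrow> complex ^ 'm"
    proof -
      let ?t = "norm (z (snd u) - z p)"
      have "norm ((z (snd u) - z p) $ q) \<le> ?t" by (rule Finite_Cartesian_Product.norm_nth_le)
      \<comment> \<open>A single coordinate difference grows only linearly; 2 t \<le> 1 + t^2 fits
        it into the quadratic condition.\<close>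
      moreover have "0 \<le> (?t - 1)\<^sup>2" by simp
      then have "2 * ?t \<le> 1 + ?t\<^sup>2" by (simp add: power2_eq_square algebra_simps)
      ultimately show ?thesis using norm_ge_zero[of "z (snd u) - z p"] by (simp del: norm_ge_zero)
    qed
    from off_diagonal_bigo[OF False this, of "fst u" j] show ?thesis by (simp add: normalized_B_def a)
  qed
qed

lemma decay_bigo: "(\<lambda>z. of_real (decay z) :: complex) \<in> O[far](\<lambda>_. 1)"
  using decay_smallo by (rule landau_o.small_imp_big)

lemma decay_square_bigo: "(\<lambda>z. (of_real (decay z) :: complex)\<^sup>2) \<in> O[far](\<lambda>z. of_real (decay z))"
  using landau_o.big.mult[OF decay_bigo landau_o.big_refl[of "\<lambda>z. of_real (decay z) :: complex"]]
  by (simp add: power2_eq_square)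

lemma bigo_decay_tendsto:
  assumes "f \<in> O[far](\<lambda>z. of_real (decay z) :: complex)"
  shows "(f \<longlongrightarrow> 0) far"
  using smalloD_tendsto[OF landau_o.big_small_trans[OF assms decay_smallo]] by simp

lemma det_normalized_A_bigo:
  "(\<lambda>z :: 'n::finite \<Rightarrow> complex ^ 'm::finite. det (normalized_A z :: complex ^ ('k::finite \<times> 'n) ^ ('k \<times> 'n)) - 1)
     \<in> O[far](\<lambda>z. (of_real (decay z))\<^sup>2)"
proof (rule det_diff_bigo[OF decay_bigo])
  show "(\<lambda>z :: 'n \<Rightarrow> complex ^ 'm. normalized_A z $ x $ x - 1) \<in> O[far](\<lambda>z. (of_real (decay z))\<^sup>2)" for x :: "'k \<times> 'n"
    by (cases x) (simp add: normalized_A_same_point)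
qed (rule normalized_A_off_diagonal)

lemma det_normalized_A_tendsto:
  "((\<lambda>z :: 'n::finite \<Rightarrow> complex ^ 'm::finite. det (normalized_A z :: complex ^ ('k::finite \<times> 'n) ^ ('k \<times> 'n))) \<longlongrightarrow> 1) far"
  using bigo_decay_tendsto[OF landau_o.big_trans[OF det_normalized_A_bigo decay_square_bigo]]
  by (simp add: LIM_zero_iff)

lemma matrix_inv_normalized_A_bigo:
  fixes u v :: "'k::finite \<times> 'n::finite"
  shows "(\<lambda>z :: 'n \<Rightarrow> complex ^ 'm::finite. matrix_inv (normalized_A z) $ u $ v) \<in> O[far](\<lambda>_. 1)"
proof (rule matrix_inv_bigo[OF _ det_normalized_A_tendsto])
  fix x y :: "'k \<times> 'n"
  show "(\<lambda>z :: 'n \<Rightarrow> complex ^ 'm. normalized_A z $ x $ y) \<in> O[far](\<lambda>_. 1)"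
  proof (cases "x = y")
    case True
    then obtain j p where "x = (j, p)" "y = (j, p)" by (cases x) auto
    then show ?thesis by (simp add: normalized_A_same_point)
  next
    case False
    then show ?thesis using landau_o.big_trans[OF normalized_A_off_diagonal decay_bigo] by blast
  qed
qed

text \<open>Both outer factors come from \<open>normalized_B\<close> and are O(decay), while the
  inverse in between is bounded.\<close>

lemma schur_correction_bigo:
  fixes a b :: "'k::finite \<times> 'n::finite \<times> 'm::finite"
  shows "(\<lambda>z. \<Sum>u\<in>UNIV. \<Sum>v\<in>UNIV. cnj (normalized_B z u a) * matrix_inv (normalized_A z :: complex ^ ('k \<times> 'n) ^ ('k \<times> 'n)) $ u $ v
      * normalized_B z v b) \<in> O[far](\<lambda>z. (of_real (decay z))\<^sup>2)"
proof (intro big_sum_in_bigo)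
  fix u v :: "'k \<times> 'n"
  have "(\<lambda>z. cnj (normalized_B z u a)) \<in> O[far](\<lambda>z. of_real (decay z))"
    using normalized_B_bigo[of u a] unfolding bigo_def by simp
  from landau_o.big.mult[OF landau_o.big.mult[OF this matrix_inv_normalized_A_bigo[of u v]] normalized_B_bigo[of v b]]
  show "(\<lambda>z. cnj (normalized_B z u a) * matrix_inv (normalized_A z :: complex ^ ('k \<times> 'n) ^ ('k \<times> 'n)) $ u $ v
      * normalized_B z v b) \<in> O[far](\<lambda>z. (of_real (decay z))\<^sup>2)"
    by (simp add: power2_eq_square)
qed

lemma normalized_Lambda_same_point:
  fixes j j' :: "'k::finite" and p :: "'n::finite" and q q' :: "'m::finite"
  shows "(\<lambda>z. normalized_Lambda z $ (j, p, q) $ (j', p, q') - of_bool (j = j' \<and> q = q')) \<in> O[far](\<lambda>z. (of_real (decay z))\<^sup>2)"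
proof -
  have "normalized_Lambda z $ (j, p, q) $ (j', p, q') - of_bool (j = j' \<and> q = q') =
     - (\<Sum>u\<in>UNIV. \<Sum>v\<in>UNIV. cnj (normalized_B z u (j, p, q)) * matrix_inv (normalized_A z :: complex ^ ('k \<times> 'n) ^ ('k \<times> 'n)) $ u $ v
      * normalized_B z v (j', p, q'))" for z :: "'n \<Rightarrow> complex ^ 'm"
    by (simp add: normalized_Lambda_def normalized_A_same_point)
  then show ?thesis using schur_correction_bigo[of "(j, p, q)" "(j', p, q')"] by simp
qed

lemma normalized_Lambda_distinct_points:
  fixes j j' :: "'k::finite" and p p' :: "'n::finite" and q q' :: "'m::finite"
  assumes "p \<noteq> p'"
  shows "(\<lambda>z. normalized_Lambda z $ (j, p, q) $ (j', p', q')) \<in> O[far](\<lambda>z. of_real (decay z))"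
proof -
  have "norm (of_bool (q = q') + (cnj (z p' $ q) - cnj (z p $ q)) * (z p $ q' - z p' $ q')) \<le> 1 + (norm (z p - z p'))\<^sup>2"
    for z :: "'n \<Rightarrow> complex ^ 'm"
  proof -
    have "norm ((z p - z p') $ q) \<le> norm (z p - z p')" "norm ((z p - z p') $ q') \<le> norm (z p - z p')"
      by (rule Finite_Cartesian_Product.norm_nth_le)+
    then have "norm (z p $ q - z p' $ q) * norm (z p $ q' - z p' $ q') \<le> (norm (z p - z p'))\<^sup>2"
      unfolding power2_eq_square by (intro mult_mono) auto
    moreover have "norm (cnj (z p' $ q) - cnj (z p $ q)) = norm (z p $ q - z p' $ q)"
      by (metis complex_cnj_diff complex_mod_cnj norm_minus_commute)
    ultimately have "norm ((cnj (z p' $ q) - cnj (z p $ q)) * (z p $ q' - z p' $ q')) \<le> (norm (z p - z p'))\<^sup>2"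
      by (simp add: norm_mult)
    moreover have "norm (of_bool (q = q') :: complex) \<le> 1" by simp
    ultimately show ?thesis by (intro order_trans[OF norm_triangle_ineq] add_mono)
  qed
  from sum_in_bigo(2)[OF off_diagonal_bigo[OF assms this, of j j']
      landau_o.big_trans[OF schur_correction_bigo[of "(j, p, q)" "(j', p', q')"] decay_square_bigo]]
  show ?thesis by (simp add: normalized_Lambda_def)
qed

text \<open>This justifies the Hilbert choice in \<open>gaussian_expectation\<close>. Dominance is
  verified for the normalized matrix, since the weights could destroy it for
  \<open>mat_Lambda\<close>.\<close>

lemma eventually_gaussian:
  "\<forall>\<^sub>F z :: 'n::finite \<Rightarrow> complex ^ 'm::finite in far.
     \<exists>\<mu>. centered_complex_gaussian (mat_Lambda z :: complex ^ ('k::finite \<times> 'n \<times> 'm) ^ ('k \<times> 'n \<times> 'm)) \<mu>"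
proof -
  let ?L = "\<lambda>z. normalized_Lambda z :: complex ^ ('k \<times> 'n \<times> 'm) ^ ('k \<times> 'n \<times> 'm)"
  \<comment> \<open>With every entry within e of the identity, off-diagonal row sums are at most 1/2
    and diagonal entries have real part at least 1/2.\<close>
  define e where "e = 1 / (2 * real CARD('k \<times> 'n \<times> 'm))"
  have e: "e > 0" "e \<le> 1 / 2" "CARD('k \<times> 'n \<times> 'm) * e = 1 / 2"
  proof -
    have "CARD('k \<times> 'n \<times> 'm) > 0" by (simp add: card_gt_0_iff)
    then have "real CARD('k \<times> 'n \<times> 'm) \<ge> 1" by linarith
    then show "e > 0" "e \<le> 1 / 2" "CARD('k \<times> 'n \<times> 'm) * e = 1 / 2"
      unfolding e_def by (simp_all add: field_simps del: card_prod)
  qed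
  have close: "\<forall>\<^sub>F z :: 'n \<Rightarrow> complex ^ 'm in far. norm (?L z $ a $ b - of_bool (a = b)) < e" for a b
  proof -
    obtain j p q where a: "a = (j, p, q)" by (cases a)
  obtain j' p' q' where b: "b = (j', p', q')" by (cases b)
  note ab = a b
    have "(\<lambda>z. ?L z $ a $ b - of_bool (a = b)) \<in> O[far](\<lambda>z. of_real (decay z))"
    proof (cases "p = p'")
      case True
      then show ?thesis
        using landau_o.big_trans[OF normalized_Lambda_same_point decay_square_bigo, of j p q j' q'] by (simp add: ab)
    next
      case False
      then show ?thesis using normalized_Lambda_distinct_points[OF False, of j q j' q'] by (simp add: ab)
    qed
    from tendstoD[OF bigo_decay_tendsto[OF this] e(1)] show ?thesis by simp
  qed
  have "\<forall>\<^sub>F z :: 'n \<Rightarrow> complex ^ 'm in far. \<forall>a b. norm (?L z $ a $ b - of_bool (a = b)) < e"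
    by (intro eventually_all_finite close)
  moreover have "\<forall>\<^sub>F z :: 'n \<Rightarrow> complex ^ 'm in far. det (normalized_A z :: complex ^ ('k \<times> 'n) ^ ('k \<times> 'n)) \<noteq> 0"
    using tendsto_imp_eventually_ne[OF det_normalized_A_tendsto, of 0] by simp
  ultimately show ?thesis
  proof eventually_elim
    case (elim z)
    have "(\<Sum>b\<in>UNIV - {a}. norm (?L z $ a $ b)) \<le> Re (?L z $ a $ a)" for a
    proof -
      have "(\<Sum>b\<in>UNIV - {a}. norm (?L z $ a $ b)) \<le> (\<Sum>b\<in>UNIV - {a}. e)"
      proof (rule sum_mono)
        fix b assume "b \<in> UNIV - {a}"
        then show "norm (?L z $ a $ b) \<le> e" using elim(1)[rule_format, of a b] by auto
      qed
      also have "\<dots> \<le> (\<Sum>b\<in>(UNIV :: ('k \<times> 'n \<times> 'm) set). e)"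
        using e by (intro sum_mono2) auto
      also have "\<dots> = 1 / 2" using e by simp
      finally have "(\<Sum>b\<in>UNIV - {a}. norm (?L z $ a $ b)) \<le> 1 / 2" .
      moreover have "norm (?L z $ a $ a - 1) \<le> 1 / 2" using elim(1)[rule_format, of a a] e(2) by simp
      then have "\<bar>Re (?L z $ a $ a) - 1\<bar> \<le> 1 / 2" using abs_Re_le_cmod[of "?L z $ a $ a - 1"] by simp
      ultimately show ?thesis by linarith
    qed
    then obtain T :: "('k \<times> 'n \<times> 'm) \<Rightarrow> ('k \<times> 'n \<times> 'm) \<times> ('k \<times> 'n \<times> 'm) \<Rightarrow> complex"
      where T: "\<And>a b. ?L z $ a $ b = (\<Sum>x\<in>UNIV. T a x * cnj (T b x))"
      using diagonally_dominant_factorization[OF normalized_Lambda_hermitian[OF elim(2)]] by blast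
    show ?case
    proof (rule centered_complex_gaussian_exists)
      fix a b
      \<comment> \<open>Multiplying the rows of the factor T by the real weights transfers the
        factorization back to \<open>mat_Lambda\<close>.\<close>
      show "mat_Lambda z $ a $ b = (\<Sum>x\<in>UNIV. (weight z (fst (snd a)) * T a x) * cnj (weight z (fst (snd b)) * T b x))"
        by (simp add: mat_Lambda_eq[OF elim(2)] T sum_distrib_left mult_ac)
    qed
  qed
qed

section \<open>The one-point constant and the final estimate\<close>

lemma limit_correlation_one_point:
  "limit_correlation TYPE('k::finite) (\<lambda>_::unit. 0 :: complex ^ 'm::finite) =
     of_nat (card {h :: 'k \<Rightarrow> 'm. inj h}) / of_real pi ^ CARD('k)"
proof -
  let ?z = "\<lambda>_::unit. 0 :: complex ^ 'm"
  have A: "mat_A ?z = (mat 1 :: complex ^ ('k \<times> unit) ^ ('k \<times> unit))"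
    by (auto simp: vec_eq_iff mat_A_def mat_def herm_dot_def)
  have B: "mat_B ?z = (0 :: complex ^ ('k \<times> unit \<times> 'm) ^ ('k \<times> unit))"
    by (auto simp: vec_eq_iff mat_B_def)
  have C: "mat_C ?z = (mat 1 :: complex ^ ('k \<times> unit \<times> 'm) ^ ('k \<times> unit \<times> 'm))"
    by (auto simp: vec_eq_iff mat_C_def mat_def herm_dot_def)
  have \<Lambda>: "mat_Lambda ?z = (mat 1 :: complex ^ ('k \<times> unit \<times> 'm) ^ ('k \<times> unit \<times> 'm))"
    by (simp add: mat_Lambda_def B C)
  have "\<exists>\<mu>. centered_complex_gaussian (mat 1 :: complex ^ ('k \<times> unit \<times> 'm) ^ ('k \<times> unit \<times> 'm)) \<mu>"
    by (rule centered_complex_gaussian_exists[where T = "\<lambda>a x. if a = x then 1 else 0"])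
       (simp add: mat_def if_distrib[of "\<lambda>x. x * _"] cong: if_cong)
  then show ?thesis
    unfolding limit_correlation_def A \<Lambda>
    by (simp add: gaussian_expectation_eq_wick_sum wick_sum_identity det_I)
qed

theorem theorem4p1:
  assumes "CARD('n::finite) \<ge> 2"
    and "CARD('k::finite) \<le> CARD('m::finite)"
  shows "(\<lambda>z :: 'n \<Rightarrow> complex ^ 'm. normalized_limit_correlation TYPE('k) z - 1)
    \<in> O[filtercomap min_separation at_top](\<lambda>z.
        of_real (min_separation z ^ 4 * exp (- (min_separation z)\<^sup>2)))"
proof -
  define c :: complex where "c = of_nat (card {h :: 'k \<Rightarrow> 'm. inj h}) ^ CARD('n)"
  have c: "c \<noteq> 0" using card_injections_pos[OF assms(2)] unfolding c_def
    by (intro power_not_zero) (simp only: of_nat_eq_0_iff neq0_conv)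
  let ?D = "\<lambda>z. det (normalized_A z :: complex ^ ('k \<times> 'n) ^ ('k \<times> 'n))"
  let ?W = "\<lambda>z. wick_sum (normalized_Lambda z :: complex ^ ('k \<times> 'n \<times> 'm) ^ ('k \<times> 'n \<times> 'm))"
  have D1: "(?D \<longlongrightarrow> 1) (far :: ('n \<Rightarrow> complex ^ 'm) filter)" by (rule det_normalized_A_tendsto)
  have D: "\<forall>\<^sub>F z :: 'n \<Rightarrow> complex ^ 'm in far. ?D z \<noteq> 0"
    using tendsto_imp_eventually_ne[OF D1, of 0] by simp
  have W_est: "(\<lambda>z :: 'n \<Rightarrow> complex ^ 'm. ?W z - c) \<in> O[far](\<lambda>z. (of_real (decay z))\<^sup>2)"
    unfolding c_def
    by (rule wick_sum_diff_bigo[OF decay_bigo normalized_Lambda_same_point normalized_Lambda_distinct_points])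
  have D_est: "(\<lambda>z :: 'n \<Rightarrow> complex ^ 'm. c * (?D z - 1)) \<in> O[far](\<lambda>z. (of_real (decay z))\<^sup>2)"
    by (simp add: det_normalized_A_bigo)
  have inv_est: "(\<lambda>z :: 'n \<Rightarrow> complex ^ 'm. inverse (c * ?D z)) \<in> O[far](\<lambda>_. 1)"
    using tendsto_inverse[OF tendsto_mult_left[OF D1, of c]] c
    by (intro bigoI_tendsto[where c = "inverse c"]) auto
  \<comment> \<open>The exact identity W / (c D) - 1 = ((W - c) - c (D - 1)) / (c D) reduces the
    claim to separate estimates for the Wick sum and the determinant, both of order decay
    squared.\<close>
  have est: "(\<lambda>z :: 'n \<Rightarrow> complex ^ 'm. ((?W z - c) - c * (?D z - 1)) * inverse (c * ?D z))
      \<in> O[far](\<lambda>z. (of_real (decay z))\<^sup>2 * 1)"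
    by (rule landau_o.big.mult[OF sum_in_bigo(2)[OF W_est D_est] inv_est])
  have ev: "\<forall>\<^sub>F z :: 'n \<Rightarrow> complex ^ 'm in far.
      normalized_limit_correlation TYPE('k) z - 1 = ((?W z - c) - c * (?D z - 1)) * inverse (c * ?D z)"
    using D eventually_gaussian[where 'k = 'k]
  proof eventually_elim
    case (elim z)
    \<comment> \<open>The weight factor shared by the Wick sum and det A; being nonzero, it cancels
      in the quotient.\<close>
    define w where "w = (\<Prod>p\<in>UNIV. weight z p ^ CARD('k))\<^sup>2"
    have w: "w \<noteq> 0" by (simp add: w_def)
    have "limit_correlation TYPE('k) z = ?W z / (of_real pi ^ (CARD('k) * CARD('n)) * ?D z)"
      unfolding limit_correlation_def gaussian_expectation_eq_wick_sum[OF elim(2)] det_mat_A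
        wick_sum_rescale[OF mat_Lambda_eq[OF elim(1)]] w_def[symmetric]
      using w by simp
    \<comment> \<open>The n-th power of the one-point value is c divided by pi to the power k n, so
      the powers of pi cancel too.\<close>
    then have "normalized_limit_correlation TYPE('k) z = ?W z / (c * ?D z)"
      unfolding normalized_limit_correlation_def limit_correlation_one_point
      by (simp add: c_def power_mult power_divide divide_inverse power_mult_distrib power_inverse)
    then show ?case using c elim(1) by (simp add: field_simps)
  qed
  have "(complex_of_real (decay z))\<^sup>2 * 1 = of_real (min_separation z ^ 4 * exp (- (min_separation z)\<^sup>2))"
    for z :: "'n \<Rightarrow> complex ^ 'm"
  proof -
    have "(exp (- (min_separation z)\<^sup>2 / 2))\<^sup>2 = exp (- (min_separation z)\<^sup>2)"
      by (simp add: power2_eq_square flip: exp_add)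
    then show ?thesis
      by (simp add: decay_def power_mult_distrib flip: of_real_power)
  qed
  with est show ?thesis by (simp only: landau_o.big.in_cong[OF ev])
qed

end
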